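(* Let $A$ be a finite left brace. Then the adjoint group $A^{\circ}$ of $A$ is nilpotent if and only if $A^{n}=0$ for some $n$. Moreover, such a brace is the direct sum of braces whose cardinalities are powers of prime numbers.
   Context: A left brace is an abelian group $(A,+)$ with a left distributive multiplication $\cdot$, i.e. $a(b+c)=ab+ac$ for all $a,b,c\in A$ (the multiplication is not assumed associative or right distributive), such that the circle operation $a\circ b=ab+a+b$ makes $A$ into a group. The group $A^{\circ}=(A,\circ)$ is called the adjoint group (or multiplicative group) of $A$. For subsets $C,D\subseteq A$, $C\cdot D$ denotes the set of all finite sums $\sum_i c_id_i$ with $c_i\in C$, $d_i\in D$. Define $A^{1}=A$ and $A^{n+1}=A\cdot A^{n}$. The direct sum of finitely many braces is the direct product of the underlying sets with componentwise addition and componentwise multiplication. *)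

theory Defs
  imports "HOL-Algebra.Algebra" "HOL-Number_Theory.Prime_Powers"
begin

(* Braces are carried by the ring record of HOL-Algebra; its field "one" plays no role.
   In a left brace a \<otimes> \<zero> = \<zero> by distributivity, so \<zero> is a right identity of the circle
   operation; it is therefore the only candidate for the identity of the adjoint group. *)

definition adjoint_group :: "('a, 'b) ring_scheme \<Rightarrow> 'a monoid" where
  "adjoint_group A = \<lparr>carrier = carrier A,
     monoid.mult = (\<lambda>a b. a \<otimes>\<^bsub>A\<^esub> b \<oplus>\<^bsub>A\<^esub> a \<oplus>\<^bsub>A\<^esub> b),
     one = \<zero>\<^bsub>A\<^esub>\<rparr>"

locale left_brace = abelian_group A for A (structure) +
  assumes mult_closed: "\<lbrakk>a \<in> carrier A; b \<in> carrier A\<rbrakk> \<Longrightarrow> a \<otimes> b \<in> carrier A"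
    and left_distrib: "\<lbrakk>a \<in> carrier A; b \<in> carrier A; c \<in> carrier A\<rbrakk>
      \<Longrightarrow> a \<otimes> (b \<oplus> c) = a \<otimes> b \<oplus> a \<otimes> c"
    and group_adjoint_group: "group (adjoint_group A)"

definition brace_set_mult :: "('a, 'b) ring_scheme \<Rightarrow> 'a set \<Rightarrow> 'a set \<Rightarrow> 'a set" where
  "brace_set_mult A C D =
     {(\<Oplus>\<^bsub>A\<^esub>i\<in>{..<n}. c i \<otimes>\<^bsub>A\<^esub> d i) | (n::nat) c d. c \<in> {..<n} \<rightarrow> C \<and> d \<in> {..<n} \<rightarrow> D}"

(* The powers start at exponent 1; the value at 0 is a dummy. *)
fun left_power :: "('a, 'b) ring_scheme \<Rightarrow> nat \<Rightarrow> 'a set" where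
  "left_power A 0 = carrier A"
| "left_power A (Suc 0) = carrier A"
| "left_power A (Suc (Suc n)) = brace_set_mult A (carrier A) (left_power A (Suc n))"

primrec lower_central_series :: "('a, 'b) monoid_scheme \<Rightarrow> nat \<Rightarrow> 'a set" where
  "lower_central_series G 0 = carrier G"
| "lower_central_series G (Suc n) =
     generate G (\<Union>h\<in>lower_central_series G n. \<Union>g\<in>carrier G.
       {h \<otimes>\<^bsub>G\<^esub> g \<otimes>\<^bsub>G\<^esub> inv\<^bsub>G\<^esub> h \<otimes>\<^bsub>G\<^esub> inv\<^bsub>G\<^esub> g})"

definition nilpotent_group :: "('a, 'b) monoid_scheme \<Rightarrow> bool" where
  "nilpotent_group G \<longleftrightarrow> group G \<and> (\<exists>n. lower_central_series G n = {\<one>\<^bsub>G\<^esub>})"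

definition brace_direct_sum :: "'i set \<Rightarrow> ('i \<Rightarrow> ('a, 'b) ring_scheme) \<Rightarrow> ('i \<Rightarrow> 'a) ring" where
  "brace_direct_sum I B = \<lparr>carrier = (\<Pi>\<^sub>E i\<in>I. carrier (B i)),
     monoid.mult = (\<lambda>x y. \<lambda>i\<in>I. x i \<otimes>\<^bsub>B i\<^esub> y i),
     one = (\<lambda>i\<in>I. \<one>\<^bsub>B i\<^esub>),
     ring.zero = (\<lambda>i\<in>I. \<zero>\<^bsub>B i\<^esub>),
     ring.add = (\<lambda>x y. \<lambda>i\<in>I. x i \<oplus>\<^bsub>B i\<^esub> y i)\<rparr>"

(* Unlike ring_iso, this does not ask for "one" to be preserved. *)
definition brace_iso :: "('a, 'c) ring_scheme \<Rightarrow> ('b, 'd) ring_scheme \<Rightarrow> ('a \<Rightarrow> 'b) set" where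
  "brace_iso A B = iso (add_monoid A) (add_monoid B) \<inter> iso A B"

end

theory Submission
  imports Defs
begin

text \<open>
  Write \<open>lam a b = a b + b\<close>, so that \<open>a \<circ> b = a + lam a b\<close>. The maps \<open>lam a\<close> are additive, and
  associativity of \<open>\<circ>\<close> makes \<open>a \<mapsto> lam a\<close> an action of the adjoint group on the additive group
  (\<open>left_brace.lam_circle\<close>). An additive subgroup stable under all \<open>lam a\<close> is therefore also a
  subgroup of the adjoint group. This applies to the primary part \<open>A\<^sub>p\<close> of the additive group, which
  has the order of a Sylow subgroup: \<open>A\<^sub>p\<close> is a Sylow subgroup of the additive and of the adjoint
  group at the same time.

  Everything is proved through one condition, \<open>primary_parts_annihilate\<close>: the product of an element
  of \<open>A\<^sub>p\<close> and an element of \<open>A\<^sub>q\<close> is zero whenever \<open>p \<noteq> q\<close>. Equivalently, \<open>A\<^sub>p\<close> acts trivially on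
  \<open>A\<^sub>q\<close>.

  The condition follows from either kind of nilpotency by the same device. Let \<open>a\<close> be in \<open>A\<^sub>p\<close> and
  \<open>b\<close> in \<open>A\<^sub>q\<close>. If the adjoint group is nilpotent, the commutator of \<open>a\<close> and \<open>b\<close> lies in every term
  of the lower central series: once it lies in one term it is central modulo the next, hence its
  order modulo the next term divides a power of \<open>p\<close> and a power of \<open>q\<close>. So \<open>a\<close> and \<open>b\<close> commute,
  \<open>a b = b a\<close>, and this element belongs to both \<open>A\<^sub>q\<close> and \<open>A\<^sub>p\<close>, so it is zero. If instead some left
  power is zero, the product \<open>c = a b\<close> lies in every left power: once it lies in one of them,
  \<open>lam a\<close> fixes \<open>c\<close> modulo the next, the \<open>m\<close>-th iterate of \<open>lam a\<close> sends \<open>b\<close> to \<open>b + m c\<close> modulo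
  the next, and again a power of \<open>p\<close> and a power of \<open>q\<close> both annihilate \<open>c\<close>.

  Conversely, the condition yields both kinds of nilpotency from one statement on group actions
  (\<open>coprime_sylow_action.descending_series_trivial\<close>), applied to \<open>lam\<close> and to conjugation in the
  adjoint group. Suppose that \<open>G\<close> acts on \<open>H\<close> and that, of the chosen Sylow subgroups, those of \<open>G\<close>
  act trivially on those of \<open>H\<close> at other primes. For a proper invariant subgroup \<open>K\<close> of \<open>H\<close> some
  Sylow subgroup of \<open>H\<close> is not contained in \<open>K\<close>, and counting fixed cosets of a \<open>p\<close>-group gives an
  element outside of \<open>K\<close> that the Sylow \<open>p\<close>-subgroup of \<open>G\<close> fixes modulo \<open>K\<close>; the other Sylow
  subgroups fix it anyway. Hence the ascending series of fixed points reaches \<open>H\<close>, and a series that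
  descends by displacements reaches the identity.

  Finally, an element \<open>x\<close> acts on \<open>A\<^sub>p\<close> as its \<open>p\<close>-component does, because the elements with this
  property form a subgroup of the adjoint group that contains every \<open>A\<^sub>q\<close>. Thus the projections onto
  the primary parts are multiplicative, and together they form the isomorphism onto the direct sum.
\<close>

section \<open>Sylow subgroups and primary components\<close>

lemma (in group) inv_mult_cancel_left:
  "\<lbrakk>a \<in> carrier G; b \<in> carrier G\<rbrakk> \<Longrightarrow> inv a \<otimes> (a \<otimes> b) = b"
  by (simp flip: m_assoc)

lemma (in group) subgroup_card_dvd:
  assumes "subgroup T G" "subgroup K G" "T \<subseteq> K"
  shows "card T dvd card K"
proof -
  interpret K: group "G\<lparr>carrier := K\<rparr>" by (rule subgroup_imp_group[OF assms(2)])
  have "card (rcosets\<^bsub>G\<lparr>carrier := K\<rparr>\<^esub> T) * card T = card K"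
    using K.lagrange[OF subgroup_incl[OF assms]] by (simp add: order_def)
  then show ?thesis using dvd_triv_right[of "card T"] by metis
qed

text \<open>The order of \<open>K\<close> is divisible by every prime power that divides the order of the group.
  Below this replaces generation by Sylow subgroups: \<open>K\<close> consists of the elements with some desired
  property, which then needs to be checked in the Sylow subgroups only.\<close>
lemma (in group) subgroup_containing_sylows_eq_carrier:
  assumes fin: "finite (carrier G)" and K: "subgroup K G"
    and T: "\<And>p. Factorial_Ring.prime p \<Longrightarrow> subgroup (T p) G"
      "\<And>p. Factorial_Ring.prime p \<Longrightarrow> card (T p) = p ^ multiplicity p (order G)"
      "\<And>p. Factorial_Ring.prime p \<Longrightarrow> T p \<subseteq> K"
  shows "K = carrier G"
proof -
  have finK: "finite K" using fin K finite_subset subgroup.subset by blast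
  have K0: "card K \<noteq> 0" using finK subgroup.one_closed[OF K] by auto
  have "order G dvd card K"
  proof (rule multiplicity_le_imp_dvd)
    show "order G \<noteq> 0" using fin order_gt_0_iff_finite by simp
    fix p :: nat assume p: "Factorial_Ring.prime p"
    have "p ^ multiplicity p (order G) dvd card K"
      using subgroup_card_dvd[OF T(1)[OF p] K T(3)[OF p]] T(2)[OF p] by simp
    then show "multiplicity p (order G) \<le> multiplicity p (card K)"
      using K0 p by (intro multiplicity_geI) auto
  qed
  then have "order G \<le> card K" using K0 by (simp add: dvd_imp_le)
  then show ?thesis
    using card_seteq[OF fin subgroup.subset[OF K]] by (simp add: order_def)
qed

lemma (in group) subgroup_pow_card_eq_one:
  assumes "subgroup T G" "x \<in> T"
  shows "x [^] card T = \<one>"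
proof -
  interpret T: group "G\<lparr>carrier := T\<rparr>" by (rule subgroup_imp_group[OF assms(1)])
  show ?thesis using T.pow_order_eq_1[of x] assms(2) nat_pow_consistent[of x "card T" T] by (simp add: order_def)
qed

text \<open>A single exponent can serve for all elements of \<open>p\<close>-power order, since their orders divide
  the \<open>p\<close>-part of the group order.\<close>
definition primary_component :: "('a, 'b) monoid_scheme \<Rightarrow> nat \<Rightarrow> 'a set" where
  "primary_component G p = {x \<in> carrier G. x [^]\<^bsub>G\<^esub> (p ^ multiplicity p (order G)) = \<one>\<^bsub>G\<^esub>}"

lemma (in comm_group) primary_component_subgroup: "subgroup (primary_component G p) G"
  unfolding primary_component_def
  by (rule subgroupI) (auto simp: pow_mult_distrib m_comm nat_pow_inv)

lemma (in group) pow_coprime_eq_one: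
  assumes x: "x \<in> carrier G" and "x [^] (m::nat) = \<one>" "x [^] (n::nat) = \<one>" "coprime m n"
  shows "x = \<one>"
proof -
  have "ord x dvd m" "ord x dvd n" using assms pow_eq_id by auto
  then have "ord x = 1" using assms(4) by (metis coprime_common_divisor_nat)
  then show ?thesis using x ord_eq_1 by simp
qed

text \<open>The component coincides with any Sylow \<open>p\<close>-subgroup \<open>P\<close>. One inclusion is Lagrange's theorem.
  For the other, an element of the component has trivial image in the quotient by \<open>P\<close>, since the
  order of that quotient is prime to \<open>p\<close>.\<close>
lemma (in comm_group) card_primary_component:
  assumes fin: "finite (carrier G)" and p: "Factorial_Ring.prime p"
  shows "card (primary_component G p) = p ^ multiplicity p (order G)"
proof -
  let ?a = "multiplicity p (order G)"
  have o0: "order G \<noteq> 0" using fin order_gt_0_iff_finite by simp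
  obtain m where m: "order G = p ^ ?a * m" and pm: "\<not> p dvd m"
  proof (rule multiplicity_decompose'[OF o0])
    show "\<not> is_unit p" using prime_gt_1_nat[OF p] by simp
  qed blast
  from pm have cop: "coprime (p ^ ?a) m" using p by (simp add: prime_imp_coprime)
  obtain P where P: "subgroup P G" "card P = p ^ ?a"
    using sylow_thm[OF p is_group m fin] by blast
  have "primary_component G p \<subseteq> P"
  proof
    fix x assume "x \<in> primary_component G p"
    then have x: "x \<in> carrier G" "x [^] (p ^ ?a) = \<one>" by (auto simp: primary_component_def)
    interpret N: normal P G using subgroup_imp_normal[OF P(1)] .
    interpret Q: group "G Mod P" by (rule N.factorgroup_is_group)
    interpret h: group_hom G "G Mod P" "\<lambda>a. P #> a"
      using N.r_coset_hom_Mod by (unfold_locales)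
    have X: "P #> x \<in> carrier (G Mod P)" using x(1) by (rule h.hom_closed)
    have "card (rcosets P) * p ^ ?a = order G" using lagrange[OF P(1)] P(2) by simp
    then have "card (rcosets P) * p ^ ?a = m * p ^ ?a" using m by (simp only: mult.commute[of m])
    then have "card (rcosets P) = m" using p by (simp add: prime_gt_0_nat)
    then have "order (G Mod P) = m" by (simp add: order_def FactGroup_def)
    then have 1: "(P #> x) [^]\<^bsub>G Mod P\<^esub> m = \<one>\<^bsub>G Mod P\<^esub>" using Q.pow_order_eq_1[OF X] by simp
    have 2: "(P #> x) [^]\<^bsub>G Mod P\<^esub> (p ^ ?a) = \<one>\<^bsub>G Mod P\<^esub>" 
      using h.hom_nat_pow[OF x(1), of "p ^ ?a"] x(2) h.hom_one by simp
    have "P #> x = P" using Q.pow_coprime_eq_one[OF X 2 1 cop] by (simp add: FactGroup_def)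
    then show "x \<in> P" using rcos_self[OF x(1) P(1)] by simp
  qed
  moreover have "P \<subseteq> primary_component G p"
    using subgroup_pow_card_eq_one[OF P(1)] P subgroup.subset[OF P(1)] 
    by (auto simp: primary_component_def)
  ultimately have "primary_component G p = P" by (rule subset_antisym)
  then show ?thesis using P(2) by simp
qed

lemma (in group) coprime_powers_in_subgroup:
  assumes K: "subgroup K G" and x: "x \<in> carrier G"
    and pow: "x [^] (m::nat) \<in> K" "x [^] (n::nat) \<in> K" "coprime m n"
  shows "x \<in> K"
proof (cases "m = 0")
  case True
  then show ?thesis using pow x by simp
next
  case False
  then obtain u v where uv: "m * u = n * v + 1" using bezout_nat[of m n] pow(3) by auto
  have Kpow: "y [^] (k::nat) \<in> K" if "y \<in> K" for y k
    using K that by (induction k) (auto simp: subgroup.one_closed subgroup.m_closed)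
  have "x [^] (m * u) = x [^] (n * v) \<otimes> x" unfolding uv using x by simp
  then have "x = inv (x [^] (n * v)) \<otimes> x [^] (m * u)" using x by (simp flip: m_assoc)
  moreover have "inv (x [^] (n * v)) \<in> K" "x [^] (m * u) \<in> K"
    using Kpow[OF pow(1), of u] Kpow[OF pow(2), of v] K x by (simp_all add: nat_pow_pow subgroup.m_inv_closed)
  ultimately show ?thesis using K by (metis subgroup.m_closed)
qed

section \<open>Coprime actions on finite groups\<close>

lemma prime_dvd_of_dvd_prime_power:
  fixes p :: nat
  assumes "Factorial_Ring.prime p" "d \<noteq> 1" "d dvd p ^ k"
  shows "p dvd d"
proof -
  obtain i where i: "d = p ^ i" using assms(3) divides_primepow_nat[OF assms(1)] by auto
  then have "i \<noteq> 0" using assms(2) by (intro notI) simp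
  then show ?thesis using i by (simp add: dvd_power)
qed

text \<open>Orbits have \<open>p\<close>-power size, so the size of each orbit with more than one point is divisible
  by \<open>p\<close>. With only one fixed point the cardinality of \<open>E\<close> would be 1 modulo \<open>p\<close>.\<close>
lemma (in group_action) p_group_second_fixed_point:
  assumes finE: "finite E" and p: "Factorial_Ring.prime p" and ord: "order G = p ^ k" and dvd: "p dvd card E"
    and x: "x \<in> E" "\<And>g. g \<in> carrier G \<Longrightarrow> \<phi> g x = x"
  obtains y where "y \<in> E" "y \<noteq> x" "\<And>g. g \<in> carrier G \<Longrightarrow> \<phi> g y = y"
proof (rule ccontr)
  assume "\<not> thesis"
  then have no: "\<And>y. y \<in> E \<Longrightarrow> y \<noteq> x \<Longrightarrow> \<exists>g \<in> carrier G. \<phi> g y \<noteq> y" using that by blast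
  interpret G: group G using group_hom group_hom.axioms(1) by blast
  interpret P: partition E "orbits G E \<phi>" by (rule orbit_partition)
  have finO: "finite (orbits G E \<phi>)" unfolding orbits_def using finE by simp
  have ox: "orbit G \<phi> x = {x}" using x orbit_refl[OF x(1)] unfolding orbit_def by auto
  then have xin: "{x} \<in> orbits G E \<phi>" unfolding orbits_def using x(1) by force
  have div: "p dvd card b" if b: "b \<in> orbits G E \<phi> - {{x}}" for b
  proof -
    obtain y where y: "y \<in> E" "b = orbit G \<phi> y" using b unfolding orbits_def by auto
    have "y \<noteq> x" using y b ox by auto
    then obtain g where g: "g \<in> carrier G" "\<phi> g y \<noteq> y" using no y by blast
    have "y \<in> b" "\<phi> g y \<in> b" using orbit_refl[OF y(1)] y g unfolding orbit_def by auto
    then have "card b \<noteq> 1" using g(2) by (auto simp: card_1_singleton_iff)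
    moreover have "card b dvd p ^ k" using dvd_triv_left[of "card b"] orbit_stabilizer_theorem[OF y(1)] ord y(2) by metis
    ultimately show ?thesis by (rule prime_dvd_of_dvd_prime_power[OF p])
  qed
  have "card E = (\<Sum>b\<in>orbits G E \<phi>. card b)"
    using P.disjoint_sum[OF finE, of "\<lambda>_. 1::nat"] by simp
  also have "\<dots> = 1 + (\<Sum>b\<in>orbits G E \<phi> - {{x}}. card b)"
    using sum.remove[OF finO xin, of card] by simp
  moreover have "p dvd (\<Sum>b\<in>orbits G E \<phi> - {{x}}. card b)" using div by (rule dvd_sum)
  ultimately have "p dvd 1" using dvd by (simp only: dvd_add_left_iff)
  then show False using p by (simp add: prime_nat_iff)
qed

locale acts_by_automorphisms = G: group G + H: group H
  for G :: "('g, 'x) monoid_scheme" and H :: "('h, 'y) monoid_scheme" +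
  fixes act :: "'g \<Rightarrow> 'h \<Rightarrow> 'h"
  assumes act_hom: "g \<in> carrier G \<Longrightarrow> act g \<in> hom H H"
    and act_mult: "\<lbrakk>g \<in> carrier G; g' \<in> carrier G; h \<in> carrier H\<rbrakk>
      \<Longrightarrow> act (g \<otimes>\<^bsub>G\<^esub> g') h = act g (act g' h)"
    and act_one: "h \<in> carrier H \<Longrightarrow> act \<one>\<^bsub>G\<^esub> h = h"
begin

text \<open>This is a commutator when a group acts on itself by conjugation, and it is the brace product
  \<open>g h\<close> when the adjoint group of a brace acts on the additive group.\<close>
abbreviation displacement :: "'g \<Rightarrow> 'h \<Rightarrow> 'h" where
  "displacement g h \<equiv> act g h \<otimes>\<^bsub>H\<^esub> inv\<^bsub>H\<^esub> h"

lemma act_closed [simp]: "\<lbrakk>g \<in> carrier G; h \<in> carrier H\<rbrakk> \<Longrightarrow> act g h \<in> carrier H"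
  using act_hom by (auto simp: hom_def)

lemma act_distrib: "\<lbrakk>g \<in> carrier G; h \<in> carrier H; h' \<in> carrier H\<rbrakk>
    \<Longrightarrow> act g (h \<otimes>\<^bsub>H\<^esub> h') = act g h \<otimes>\<^bsub>H\<^esub> act g h'"
  using act_hom by (auto simp: hom_def)

lemma act_inv: "\<lbrakk>g \<in> carrier G; h \<in> carrier H\<rbrakk> \<Longrightarrow> act g (inv\<^bsub>H\<^esub> h) = inv\<^bsub>H\<^esub> (act g h)"
  using group_hom.hom_inv[of H H "act g" h] act_hom
  by (simp add: group_hom_def group_hom_axioms_def)

lemma act_inv_act:
  assumes "g \<in> carrier G" "h \<in> carrier H" 
  shows "act (inv\<^bsub>G\<^esub> g) (act g h) = h" "act g (act (inv\<^bsub>G\<^esub> g) h) = h"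
  using assms act_mult[of "inv\<^bsub>G\<^esub> g" g h] act_mult[of g "inv\<^bsub>G\<^esub> g" h] by (simp_all add: act_one)

lemma act_rcoset:
  assumes S: "subgroup S G" and L: "subgroup L H" "\<And>g h. g \<in> S \<Longrightarrow> h \<in> L \<Longrightarrow> act g h \<in> L"
    and g: "g \<in> S" and h: "h \<in> carrier H"
  shows "act g ` (L #>\<^bsub>H\<^esub> h) = L #>\<^bsub>H\<^esub> act g h"
proof -
  have gG: "g \<in> carrier G" and ig: "inv\<^bsub>G\<^esub> g \<in> S"
    using S g by (auto simp: subgroup.mem_carrier subgroup.m_inv_closed)
  have LH: "l \<in> carrier H" if "l \<in> L" for l using L(1) that by (rule subgroup.mem_carrier)
  have "act g ` L = L"
  proof
    show "act g ` L \<subseteq> L" using L(2) g by auto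
    show "L \<subseteq> act g ` L"
    proof
      fix l assume l: "l \<in> L"
      then have "l = act g (act (inv\<^bsub>G\<^esub> g) l)" using act_inv_act(2)[OF gG LH[OF l]] by simp
      then show "l \<in> act g ` L" using L(2)[OF ig l] by blast
    qed
  qed
  moreover have "act g ` (L #>\<^bsub>H\<^esub> h) = (\<lambda>l. l \<otimes>\<^bsub>H\<^esub> act g h) ` act g ` L"
    using LH h gG by (force simp: r_coset_def image_iff act_distrib)
  ultimately show ?thesis by (auto simp: r_coset_def)
qed

text \<open>The group \<open>S\<close> permutes the right cosets of \<open>L\<close> in \<open>T\<close>. Their number is a nontrivial power of
  \<open>p\<close> and \<open>L\<close> itself is fixed, so another coset is fixed as well; its elements are moved only within
  their coset.\<close>
lemma p_group_displacement_in_subgroup: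
  assumes p: "Factorial_Ring.prime p" and S: "subgroup S G" "card S = p ^ k"
    and T: "subgroup T H" "card T = p ^ j" "\<And>g h. g \<in> S \<Longrightarrow> h \<in> T \<Longrightarrow> act g h \<in> T"
    and L: "subgroup L H" "\<And>g h. g \<in> S \<Longrightarrow> h \<in> L \<Longrightarrow> act g h \<in> L" and LT: "L \<subset> T"
  obtains h where "h \<in> T" "h \<notin> L" "\<And>g. g \<in> S \<Longrightarrow> displacement g h \<in> L"
proof -
  define E where "E = (\<lambda>h. L #>\<^bsub>H\<^esub> h) ` T"
  define \<phi> where "\<phi> = (\<lambda>g. \<lambda>C\<in>E. act g ` C)"
  note SG = subgroup.mem_carrier[OF S(1)]
  note TH = subgroup.mem_carrier[OF T(1)]
  note LH = subgroup.mem_carrier[OF L(1)]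
  have finT: "finite T" using T(2) p by (intro card_ge_0_finite) (simp add: prime_gt_0_nat)
  interpret S: group "G\<lparr>carrier := S\<rparr>" by (rule G.subgroup_imp_group[OF S(1)])
  interpret T: group "H\<lparr>carrier := T\<rparr>" by (rule H.subgroup_imp_group[OF T(1)])
  have E: "E = rcosets\<^bsub>H\<lparr>carrier := T\<rparr>\<^esub> L" by (auto simp: E_def RCOSETS_def r_coset_def)
  have \<phi>E: "\<phi> g (L #>\<^bsub>H\<^esub> h) = L #>\<^bsub>H\<^esub> act g h" if "g \<in> S" "h \<in> T" for g h
    using act_rcoset[OF S(1) L] that TH by (auto simp: \<phi>_def E_def)
  have inE: "L #>\<^bsub>H\<^esub> act g h \<in> E" if "g \<in> S" "h \<in> T" for g h
    using T(3) that by (auto simp: E_def)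
  have Sinv: "inv\<^bsub>G\<^esub> g \<in> S" if "g \<in> S" for g using S(1) that by (rule subgroup.m_inv_closed)
  have bij: "bij_betw (\<phi> g) E E" if g: "g \<in> S" for g
  proof (rule bij_betw_byWitness[where f' = "\<phi> (inv\<^bsub>G\<^esub> g)"])
    show "\<forall>C\<in>E. \<phi> (inv\<^bsub>G\<^esub> g) (\<phi> g C) = C" "\<forall>C\<in>E. \<phi> g (\<phi> (inv\<^bsub>G\<^esub> g) C) = C"
      using g Sinv[OF g] T(3) by (auto simp: E_def \<phi>E act_inv_act SG TH)
    show "\<phi> g ` E \<subseteq> E" "\<phi> (inv\<^bsub>G\<^esub> g) ` E \<subseteq> E"
      using g Sinv[OF g] T(3) by (auto simp: E_def \<phi>E)
  qed
  have act: "group_action (G\<lparr>carrier := S\<rparr>) E \<phi>"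
    unfolding group_action_def group_hom_def group_hom_axioms_def
  proof (intro conjI)
    show "Group.group (G\<lparr>carrier := S\<rparr>)" ..
    show "Group.group (BijGroup E)" by (rule group_BijGroup)
    show "\<phi> \<in> hom (G\<lparr>carrier := S\<rparr>) (BijGroup E)"
    proof (rule homI)
      fix g assume "g \<in> carrier (G\<lparr>carrier := S\<rparr>)"
      then show "\<phi> g \<in> carrier (BijGroup E)"
        using bij[of g] by (simp add: BijGroup_def Bij_def \<phi>_def)
    next
      fix g g' assume "g \<in> carrier (G\<lparr>carrier := S\<rparr>)" "g' \<in> carrier (G\<lparr>carrier := S\<rparr>)"
      then have g: "g \<in> S" "g' \<in> S" by auto
      then have gg: "g \<otimes>\<^bsub>G\<^esub> g' \<in> S" using S(1) by (simp add: subgroup.m_closed)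
      have "\<phi> (g \<otimes>\<^bsub>G\<^esub> g') = compose E (\<phi> g) (\<phi> g')"
      proof
        fix C
        show "\<phi> (g \<otimes>\<^bsub>G\<^esub> g') C = compose E (\<phi> g) (\<phi> g') C"
        proof (cases "C \<in> E")
          case True
          then obtain h where h: "h \<in> T" "C = L #>\<^bsub>H\<^esub> h" by (auto simp: E_def)
          then show ?thesis using g gg T(3) True
            by (simp add: compose_def \<phi>E act_mult SG TH)
        qed (simp add: \<phi>_def compose_def)
      qed
      then show "\<phi> (g \<otimes>\<^bsub>G\<lparr>carrier := S\<rparr>\<^esub> g') = \<phi> g \<otimes>\<^bsub>BijGroup E\<^esub> \<phi> g'"
        using bij g by (simp add: BijGroup_def Bij_def \<phi>_def)
    qed
  qed
  have fE: "finite E" using finT by (simp add: E_def)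
  have "card E * card L = p ^ j"
    using T.lagrange[OF H.subgroup_incl[OF L(1) T(1)]] LT T(2) by (simp add: E order_def)
  moreover have "card L < card T" using LT finT by (simp add: psubset_card_mono)
  ultimately have "card E \<noteq> 1" "card E dvd p ^ j"
    using T(2) dvd_triv_left[of "card E" "card L"] by auto
  then have pE: "p dvd card E" by (rule prime_dvd_of_dvd_prime_power[OF p])
  have one: "L #>\<^bsub>H\<^esub> \<one>\<^bsub>H\<^esub> = L" using H.coset_mult_one L(1) subgroup.subset by blast
  have oneT: "\<one>\<^bsub>H\<^esub> \<in> T" using T(1) by (rule subgroup.one_closed)
  have act1: "act g \<one>\<^bsub>H\<^esub> = \<one>\<^bsub>H\<^esub>" if "g \<in> S" for g
    using act_distrib[of g "\<one>\<^bsub>H\<^esub>" "\<one>\<^bsub>H\<^esub>"] SG[OF that] by (simp add: H.r_cancel_one')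
  have LE: "L \<in> E" using one oneT unfolding E_def by (metis image_eqI)
  have Lfix: "\<phi> g L = L" if "g \<in> S" for g using \<phi>E[OF that oneT] one act1[OF that] by simp
  have ordS: "order (G\<lparr>carrier := S\<rparr>) = p ^ k" using S(2) by (simp add: order_def)
  obtain C where C: "C \<in> E" "C \<noteq> L" "\<And>g. g \<in> S \<Longrightarrow> \<phi> g C = C"
    using group_action.p_group_second_fixed_point[OF act fE p ordS pE LE] Lfix by auto
  then obtain h where h: "h \<in> T" "C = L #>\<^bsub>H\<^esub> h" by (auto simp: E_def)
  have "h \<notin> L" using C(2) h H.coset_join2[OF TH[OF h(1)] L(1)] by auto
  moreover have "displacement g h \<in> L" if g: "g \<in> S" for g
  proof -
    have "act g h \<in> L #>\<^bsub>H\<^esub> act g h" using H.rcos_self[OF _ L(1)] SG TH g h(1) by simp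
    then have "act g h \<in> L #>\<^bsub>H\<^esub> h" using C(3)[OF g] \<phi>E[OF g h(1)] h(2) by simp
    then obtain l where "l \<in> L" "act g h = l \<otimes>\<^bsub>H\<^esub> h" by (auto simp: r_coset_def)
    then show ?thesis using LH TH[OF h(1)] by (simp add: H.m_assoc)
  qed
  ultimately show ?thesis using that h(1) by blast
qed

text \<open>The preimages of successive fixed points, which generalise the upper central series; the
  latter is the case of conjugation.\<close>
primrec fixed_series :: "nat \<Rightarrow> 'h set" where
  "fixed_series 0 = {\<one>\<^bsub>H\<^esub>}"
| "fixed_series (Suc n) = {h \<in> carrier H. \<forall>g\<in>carrier G. displacement g h \<in> fixed_series n}"

definition invariant_subgroup :: "'h set \<Rightarrow> bool" where
  "invariant_subgroup K \<longleftrightarrow> subgroup K H \<and> (\<forall>g\<in>carrier G. \<forall>h\<in>K. act g h \<in> K)"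

lemma displacement_mult:
  assumes "g \<in> carrier G" "g' \<in> carrier G" "h \<in> carrier H"
  shows "displacement (g \<otimes>\<^bsub>G\<^esub> g') h = act g (displacement g' h) \<otimes>\<^bsub>H\<^esub> displacement g h"
  using assms by (simp add: act_mult act_distrib act_inv H.m_assoc flip: H.m_assoc[of "inv\<^bsub>H\<^esub> act g h"])

text \<open>By the cocycle identity \<open>displacement_mult\<close>, it suffices to control displacements of \<open>h\<close> on
  the Sylow subgroups of \<open>G\<close>.\<close>
lemma displacement_stabiliser_subgroup:
  assumes K: "invariant_subgroup K" and h: "h \<in> carrier H"
  shows "subgroup {g \<in> carrier G. displacement g h \<in> K} G"
proof (rule G.subgroupI)
  note K' = K[unfolded invariant_subgroup_def]
  show "{g \<in> carrier G. displacement g h \<in> K} \<noteq> {}"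
    using act_one[OF h] h K' by (auto intro!: exI[of _ "\<one>\<^bsub>G\<^esub>"] simp: subgroup.one_closed)
  show "inv\<^bsub>G\<^esub> g \<in> {g \<in> carrier G. displacement g h \<in> K}"
    if g: "g \<in> {g \<in> carrier G. displacement g h \<in> K}" for g
  proof -
    have *: "displacement (inv\<^bsub>G\<^esub> g) h = act (inv\<^bsub>G\<^esub> g) (inv\<^bsub>H\<^esub> (displacement g h))"
      using g h by (simp add: H.inv_mult_group act_distrib act_inv act_inv_act)
    have "inv\<^bsub>H\<^esub> (displacement g h) \<in> K" using g K' by (simp add: subgroup.m_inv_closed)
    then have "displacement (inv\<^bsub>G\<^esub> g) h \<in> K" using K' g unfolding * by simp
    then show ?thesis using g by simp
  qed
  show "g \<otimes>\<^bsub>G\<^esub> g' \<in> {g \<in> carrier G. displacement g h \<in> K}"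
    if "g \<in> {g \<in> carrier G. displacement g h \<in> K}" "g' \<in> {g \<in> carrier G. displacement g h \<in> K}" for g g'
    using that h K' by (simp add: displacement_mult subgroup.m_closed)
qed auto

end

text \<open>Both the action of the adjoint group on the additive group of a brace and its action on
  itself by conjugation are of this form. Normality of invariant subgroups is built into
  conjugation and automatic for commutative \<open>H\<close>; it makes the fixed series consist of subgroups.\<close>
locale coprime_sylow_action = acts_by_automorphisms +
  fixes S :: "nat \<Rightarrow> 'a set" and T :: "nat \<Rightarrow> 'c set"
  assumes finite_G: "finite (carrier G)" and finite_H: "finite (carrier H)"
    and S_subgroup: "Factorial_Ring.prime p \<Longrightarrow> subgroup (S p) G"
    and S_card: "Factorial_Ring.prime p \<Longrightarrow> card (S p) = p ^ multiplicity p (order G)"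
    and T_subgroup: "Factorial_Ring.prime p \<Longrightarrow> subgroup (T p) H"
    and T_card: "Factorial_Ring.prime p \<Longrightarrow> card (T p) = p ^ multiplicity p (order H)"
    and S_T_invariant: "\<lbrakk>Factorial_Ring.prime p; g \<in> S p; h \<in> T p\<rbrakk> \<Longrightarrow> act g h \<in> T p"
    and S_T_trivial: "\<lbrakk>Factorial_Ring.prime p; Factorial_Ring.prime q; p \<noteq> q; g \<in> S q; h \<in> T p\<rbrakk> \<Longrightarrow> act g h = h"
    and invariant_normal: "invariant_subgroup K \<Longrightarrow> K \<lhd> H"
begin

lemma S_carrier: "Factorial_Ring.prime p \<Longrightarrow> g \<in> S p \<Longrightarrow> g \<in> carrier G"
  by (meson S_subgroup subgroup.mem_carrier)

lemma T_carrier: "Factorial_Ring.prime p \<Longrightarrow> h \<in> T p \<Longrightarrow> h \<in> carrier H"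
  by (meson T_subgroup subgroup.mem_carrier)

text \<open>Since \<open>K\<close> is proper, it misses part of some \<open>T p\<close>, and there the \<open>p\<close>-group \<open>S p\<close> leaves an
  element outside of \<open>K\<close> fixed modulo \<open>K\<close>. The other \<open>S q\<close> do not move this element at all.\<close>
lemma invariant_subgroup_displacement:
  assumes K: "invariant_subgroup K" and "K \<noteq> carrier H"
  obtains h where "h \<in> carrier H" "h \<notin> K" "\<And>g. g \<in> carrier G \<Longrightarrow> displacement g h \<in> K"
proof -
  have Ksub: "subgroup K H" and Kinv: "\<And>g h. g \<in> carrier G \<Longrightarrow> h \<in> K \<Longrightarrow> act g h \<in> K" 
    using K by (auto simp: invariant_subgroup_def)
  obtain p where p: "Factorial_Ring.prime p" "\<not> T p \<subseteq> K"
    using H.subgroup_containing_sylows_eq_carrier[OF finite_H Ksub] T_subgroup T_card assms(2) by blast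
  have L: "subgroup (K \<inter> T p) H" using Ksub T_subgroup[OF p(1)] by (rule H.subgroups_Inter_pair)
  obtain h where h: "h \<in> T p" "h \<notin> K \<inter> T p"
      and hp: "\<And>g. g \<in> S p \<Longrightarrow> displacement g h \<in> K \<inter> T p"
  proof (rule p_group_displacement_in_subgroup[OF p(1) S_subgroup[OF p(1)] S_card[OF p(1)]
        T_subgroup[OF p(1)] T_card[OF p(1)] S_T_invariant[OF p(1)] L])
    show "act g h \<in> K \<inter> T p" if "g \<in> S p" "h \<in> K \<inter> T p" for g h
      using that Kinv S_T_invariant p(1) S_carrier by blast
    show "K \<inter> T p \<subset> T p" using p(2) by blast
  qed blast+
  have hH: "h \<in> carrier H" using T_carrier p h by blast
  have "{g \<in> carrier G. displacement g h \<in> K} = carrier G"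
  proof (rule G.subgroup_containing_sylows_eq_carrier[OF finite_G
        displacement_stabiliser_subgroup[OF K hH]])
    fix q :: nat assume q: "Factorial_Ring.prime q"
    show "S q \<subseteq> {g \<in> carrier G. displacement g h \<in> K}"
    proof (cases "q = p")
      case True then show ?thesis using hp S_carrier p by auto
    next
      case False
      then show ?thesis
        using S_T_trivial[OF p(1) q] h hH S_carrier[OF q] subgroup.one_closed[OF Ksub] by auto
    qed
  qed (use S_subgroup S_card in auto)
  then show ?thesis using that[of h] h hH by blast
qed

lemma fixed_series_invariant: "invariant_subgroup (fixed_series n)"
proof (induction n)
  case 0
  have "act g \<one>\<^bsub>H\<^esub> = \<one>\<^bsub>H\<^esub>" if "g \<in> carrier G" for g
    using act_distrib[of g "\<one>\<^bsub>H\<^esub>" "\<one>\<^bsub>H\<^esub>"] that by (simp add: H.r_cancel_one')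
  then show ?case by (simp add: invariant_subgroup_def H.triv_subgroup)
next
  case (Suc n)
  let ?Z = "fixed_series n"
  interpret Z: normal ?Z H using invariant_normal[OF Suc] .
  have inv: "act g z \<in> ?Z" if "g \<in> carrier G" "z \<in> ?Z" for g z
    using Suc that by (auto simp: invariant_subgroup_def)
  have sub: "subgroup (fixed_series (Suc n)) H"
  proof (rule H.subgroupI)
    show "fixed_series (Suc n) \<noteq> {}"
      using inv Z.one_closed by (auto intro!: exI[of _ "\<one>\<^bsub>H\<^esub>"])
    show "inv\<^bsub>H\<^esub> h \<in> fixed_series (Suc n)" if h: "h \<in> fixed_series (Suc n)" for h
    proof -
      have "displacement g (inv\<^bsub>H\<^esub> h) \<in> ?Z" if g: "g \<in> carrier G" for g
      proof -
        have "displacement g (inv\<^bsub>H\<^esub> h) = inv\<^bsub>H\<^esub> h \<otimes>\<^bsub>H\<^esub> inv\<^bsub>H\<^esub> (displacement g h) \<otimes>\<^bsub>H\<^esub> h"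
          using h g by (simp add: act_inv H.inv_mult_group flip: H.m_assoc)
        then show ?thesis using Z.inv_op_closed1[of h "inv\<^bsub>H\<^esub> (displacement g h)"] h g by simp
      qed
      then show ?thesis using h by simp
    qed
    show "h \<otimes>\<^bsub>H\<^esub> h' \<in> fixed_series (Suc n)"
      if h: "h \<in> fixed_series (Suc n)" "h' \<in> fixed_series (Suc n)" for h h'
    proof -
      have "displacement g (h \<otimes>\<^bsub>H\<^esub> h') \<in> ?Z" if g: "g \<in> carrier G" for g
      proof -
        have "displacement g (h \<otimes>\<^bsub>H\<^esub> h') = 
            displacement g h \<otimes>\<^bsub>H\<^esub> (h \<otimes>\<^bsub>H\<^esub> displacement g h' \<otimes>\<^bsub>H\<^esub> inv\<^bsub>H\<^esub> h)"
          using h g by (simp add: act_distrib H.inv_mult_group H.m_assoc flip: H.m_assoc[of "inv\<^bsub>H\<^esub> h"])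
        then show ?thesis using Z.inv_op_closed2[of h "displacement g h'"] h g by simp
      qed
      then show ?thesis using h by simp
    qed
  qed auto
  have "act g h \<in> fixed_series (Suc n)" if "g \<in> carrier G" "h \<in> fixed_series (Suc n)" for g h
  proof -
    have "displacement g' (act g h) \<in> ?Z" if g': "g' \<in> carrier G" for g'
    proof -
      have "displacement g' (act g h) = displacement (g' \<otimes>\<^bsub>G\<^esub> g) h \<otimes>\<^bsub>H\<^esub> inv\<^bsub>H\<^esub> (displacement g h)"
        using that \<open>g \<in> carrier G\<close> \<open>h \<in> fixed_series (Suc n)\<close>
        by (simp add: act_mult H.inv_mult_group H.m_assoc flip: H.m_assoc[of "inv\<^bsub>H\<^esub> h"])
      then show ?thesis using that \<open>g \<in> carrier G\<close> \<open>h \<in> fixed_series (Suc n)\<close> by simp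
    qed
    then show ?thesis using that by simp
  qed
  then show ?case using sub by (auto simp only: invariant_subgroup_def)
qed

lemma fixed_series_mono: "fixed_series n \<subseteq> fixed_series (Suc n)"
  using fixed_series_invariant[of n]
  by (auto simp: invariant_subgroup_def subgroup.mem_carrier subgroup.m_closed subgroup.m_inv_closed)

lemma fixed_series_reaches_carrier: "\<exists>n. fixed_series n = carrier H"
proof (rule ccontr)
  assume no: "\<nexists>n. fixed_series n = carrier H"
  have sub: "fixed_series n \<subseteq> carrier H" for n
    using fixed_series_invariant[of n] by (simp add: invariant_subgroup_def subgroup.subset)
  have "fixed_series n \<subset> fixed_series (Suc n)" for n
  proof -
    have "fixed_series n \<noteq> carrier H" using no by blast
    then obtain h where "h \<in> carrier H" "h \<notin> fixed_series n"
        "\<And>g. g \<in> carrier G \<Longrightarrow> displacement g h \<in> fixed_series n"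
      using invariant_subgroup_displacement[OF fixed_series_invariant[of n]] by blast
    then have "h \<in> fixed_series (Suc n)" by simp
    then show ?thesis using fixed_series_mono[of n] \<open>h \<notin> fixed_series n\<close> by blast
  qed
  then have lt: "card (fixed_series n) < card (fixed_series (Suc n))" for n
    using psubset_card_mono[OF finite_subset[OF sub finite_H]] by blast
  have "n \<le> card (fixed_series n)" for n
  proof (induction n)
    case (Suc n) then show ?case using lt[of n] by simp
  qed simp
  moreover have "card (fixed_series n) \<le> card (carrier H)" for n
    using sub finite_H by (simp add: card_mono)
  ultimately show False using Suc_n_not_le_n order_trans by blast
qed

text \<open>If the fixed series reaches \<open>H\<close> at step \<open>n\<close>, then \<open>D i\<close> is contained in its term \<open>n - i\<close>.
  Quantifying over all subgroups \<open>K\<close> covers any series whose next term is generated by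
  displacements, in particular the lower central series and the left powers.\<close>
theorem descending_series_trivial:
  assumes D0: "D 0 \<subseteq> carrier H"
    and DSuc: "\<And>n K. \<lbrakk>subgroup K H; \<And>g h. \<lbrakk>g \<in> carrier G; h \<in> D n\<rbrakk> \<Longrightarrow> displacement g h \<in> K\<rbrakk>
      \<Longrightarrow> D (Suc n) \<subseteq> K"
  shows "\<exists>n. D n \<subseteq> {\<one>\<^bsub>H\<^esub>}"
proof -
  obtain n where n: "fixed_series n = carrier H" using fixed_series_reaches_carrier by blast
  have "i \<le> n \<Longrightarrow> D i \<subseteq> fixed_series (n - i)" for i
  proof (induction i)
    case 0 then show ?case using n D0 by simp
  next
    case (Suc i)
    then have "D i \<subseteq> fixed_series (Suc (n - Suc i))" by (simp add: Suc_diff_Suc)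
    then show ?case using fixed_series_invariant[of "n - Suc i"]
      by (intro DSuc) (auto simp: invariant_subgroup_def)
  qed
  from this[of n] show ?thesis by auto
qed

end

section \<open>Elements of coprime order in nilpotent groups\<close>

text \<open>Conjugation permutes the commutators that generate the next term.\<close>
lemma (in group) lower_central_series_normal: "lower_central_series G n \<lhd> G"
proof (induction n)
  case 0
  have "carrier G \<lhd> G" by (rule normal_invI[OF subgroup_self]) auto
  then show ?case by simp
next
  case (Suc n)
  let ?L = "lower_central_series G n"
  let ?C = "\<Union>h\<in>?L. \<Union>g\<in>carrier G. {h \<otimes> g \<otimes> inv h \<otimes> inv g}"
  interpret L: normal ?L G by (rule Suc)
  have "generate G ?C \<lhd> G"
  proof (rule normal_generateI)
    show "?C \<subseteq> carrier G" using L.mem_carrier by auto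
    fix c k assume "c \<in> ?C" and k: "k \<in> carrier G"
    then obtain h g where hg: "h \<in> ?L" "g \<in> carrier G" "c = h \<otimes> g \<otimes> inv h \<otimes> inv g" by auto
    then have h: "h \<in> carrier G" using L.mem_carrier by blast
    have "k \<otimes> c \<otimes> inv k = (k \<otimes> h \<otimes> inv k) \<otimes> (k \<otimes> g \<otimes> inv k)
        \<otimes> inv (k \<otimes> h \<otimes> inv k) \<otimes> inv (k \<otimes> g \<otimes> inv k)"
      using k h hg(2) by (simp add: hg(3) inv_mult_group m_assoc inv_mult_cancel_left)
    moreover have "k \<otimes> h \<otimes> inv k \<in> ?L" using L.inv_op_closed2 k hg(1) by blast
    ultimately show "k \<otimes> c \<otimes> inv k \<in> ?C" using k hg(2) by blast
  qed
  then show ?case by simp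
qed

lemma (in group) pow_mult_central_commutator:
  assumes x: "x \<in> carrier G" and y: "y \<in> carrier G" and c: "c \<in> carrier G"
    and xy: "x \<otimes> y = c \<otimes> y \<otimes> x" and cx: "c \<otimes> x = x \<otimes> c"
  shows "x [^] (k::nat) \<otimes> y = c [^] k \<otimes> y \<otimes> x [^] k"
proof (induction k)
  case 0 then show ?case using y by simp
next
  case (Suc k)
  have "x [^] Suc k \<otimes> y = x [^] k \<otimes> c \<otimes> y \<otimes> x"
    using x y c xy by (simp add: m_assoc)
  also have "x [^] k \<otimes> c = c \<otimes> x [^] k"
    using group_commutes_pow[OF cx[symmetric] x c, of k] by simp
  also have "c \<otimes> x [^] k \<otimes> y \<otimes> x = c \<otimes> (x [^] k \<otimes> y) \<otimes> x" using x y c by (simp add: m_assoc)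
  also have "\<dots> = c \<otimes> c [^] k \<otimes> y \<otimes> (x [^] k \<otimes> x)" using x y c Suc by (simp add: m_assoc)
  finally show ?case using x c by (simp add: nat_pow_Suc2[OF c, symmetric])
qed

lemma (in group) commute_if_commutator_eq_one:
  assumes x: "x \<in> carrier G" and y: "y \<in> carrier G" and e: "x \<otimes> y \<otimes> inv x \<otimes> inv y = \<one>"
  shows "x \<otimes> y = y \<otimes> x"
proof -
  have "x \<otimes> y = (x \<otimes> y \<otimes> inv x \<otimes> inv y) \<otimes> (y \<otimes> x)" using x y by (simp add: m_assoc inv_mult_cancel_left)
  then show ?thesis using x y by (simp add: e)
qed

text \<open>As the commutator \<open>c\<close> is central, passing \<open>x\<^sup>m\<close> across \<open>y\<close> produces \<open>c\<^sup>m\<close> and passing \<open>y\<^sup>n\<close>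
  across \<open>x\<close> produces the inverse of \<open>c\<^sup>n\<close>. Both are trivial, so the order of \<open>c\<close> divides
  \<open>m\<close> and \<open>n\<close>.\<close>
lemma (in group) coprime_powers_central_commutator:
  assumes x: "x \<in> carrier G" and y: "y \<in> carrier G"
    and pow: "x [^] (m::nat) = \<one>" "y [^] (n::nat) = \<one>" "coprime m n"
    and central: "\<And>g. g \<in> carrier G \<Longrightarrow>
      (x \<otimes> y \<otimes> inv x \<otimes> inv y) \<otimes> g = g \<otimes> (x \<otimes> y \<otimes> inv x \<otimes> inv y)"
  shows "x \<otimes> y \<otimes> inv x \<otimes> inv y = \<one>"
proof -
  define c where "c = x \<otimes> y \<otimes> inv x \<otimes> inv y"
  have c: "c \<in> carrier G" using x y by (simp add: c_def)
  have cen: "c \<otimes> g = g \<otimes> c" if "g \<in> carrier G" for g using central[OF that] by (simp add: c_def)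
  have xy: "x \<otimes> y = c \<otimes> y \<otimes> x" using x y by (simp add: c_def m_assoc inv_mult_cancel_left)
  have yx: "y \<otimes> x = inv c \<otimes> x \<otimes> y"
    using x y c xy by (simp add: m_assoc inv_mult_cancel_left)
  have cy: "inv c \<otimes> y = y \<otimes> inv c"
    using cen[OF y] c y by (metis inv_closed m_assoc inv_solve_left inv_solve_right m_closed)
  have "y = c [^] m \<otimes> y" 
    using pow_mult_central_commutator[OF x y c xy cen[OF x], of m] pow(1) x y c by simp
  then have 1: "c [^] m = \<one>" using y c by (simp add: r_cancel_one')
  have "x = inv c [^] n \<otimes> x"
    using pow_mult_central_commutator[OF y x _ yx cy, of n] pow(2) x y c by simp
  then have "inv c [^] n = \<one>" using x c by (simp add: r_cancel_one')
  then have 2: "c [^] n = \<one>" using c by (simp add: nat_pow_inv inv_eq_1_iff)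
  show ?thesis using pow_coprime_eq_one[OF c 1 2 pow(3)] by (simp add: c_def)
qed

text \<open>The commutator of \<open>x\<close> and \<open>y\<close> lies in every term of the lower central series, by induction:
  if it lies in one term, its image modulo the next term is central, hence trivial.\<close>
lemma nilpotent_group_coprime_commute:
  assumes nil: "nilpotent_group G" and x: "x \<in> carrier G" and y: "y \<in> carrier G"
    and pow: "x [^]\<^bsub>G\<^esub> (m::nat) = \<one>\<^bsub>G\<^esub>" "y [^]\<^bsub>G\<^esub> (n::nat) = \<one>\<^bsub>G\<^esub>" "coprime m n"
  shows "x \<otimes>\<^bsub>G\<^esub> y = y \<otimes>\<^bsub>G\<^esub> x"
proof -
  interpret group G using nil by (simp add: nilpotent_group_def)
  let ?c = "x \<otimes>\<^bsub>G\<^esub> y \<otimes>\<^bsub>G\<^esub> inv\<^bsub>G\<^esub> x \<otimes>\<^bsub>G\<^esub> inv\<^bsub>G\<^esub> y"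
  have cG: "?c \<in> carrier G" using x y by simp
  have "?c \<in> lower_central_series G k" for k
  proof (induction k)
    case 0 then show ?case using cG by simp
  next
    case (Suc k)
    let ?N = "lower_central_series G (Suc k)"
    interpret N: normal ?N G by (rule lower_central_series_normal)
    interpret Q: group "G Mod ?N" by (rule N.factorgroup_is_group)
    interpret h: group_hom G "G Mod ?N" "\<lambda>a. ?N #>\<^bsub>G\<^esub> a"
      using N.r_coset_hom_Mod by (unfold_locales)
    let ?h = "\<lambda>a. ?N #>\<^bsub>G\<^esub> a"
    have hc: "?h ?c = ?h x \<otimes>\<^bsub>G Mod ?N\<^esub> ?h y \<otimes>\<^bsub>G Mod ?N\<^esub> inv\<^bsub>G Mod ?N\<^esub> ?h x \<otimes>\<^bsub>G Mod ?N\<^esub> inv\<^bsub>G Mod ?N\<^esub> ?h y"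
      using x y by (simp del: lower_central_series.simps)
    have "?h ?c = \<one>\<^bsub>G Mod ?N\<^esub>" unfolding hc
    proof (rule Q.coprime_powers_central_commutator)
      show "?h x \<in> carrier (G Mod ?N)" "?h y \<in> carrier (G Mod ?N)" using x y h.hom_closed by blast+
      show "?h x [^]\<^bsub>G Mod ?N\<^esub> m = \<one>\<^bsub>G Mod ?N\<^esub>" "?h y [^]\<^bsub>G Mod ?N\<^esub> n = \<one>\<^bsub>G Mod ?N\<^esub>"
        using h.hom_nat_pow[OF x, of m] h.hom_nat_pow[OF y, of n] pow h.hom_one by simp_all
      fix u assume "u \<in> carrier (G Mod ?N)"
      then obtain g where g: "g \<in> carrier G" "u = ?h g" by (auto simp: FactGroup_def RCOSETS_def)
      have "?c \<otimes>\<^bsub>G\<^esub> g \<otimes>\<^bsub>G\<^esub> inv\<^bsub>G\<^esub> ?c \<otimes>\<^bsub>G\<^esub> inv\<^bsub>G\<^esub> g \<in> ?N"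
        using Suc g(1) by (auto intro!: generate.incl)
      then have "?h (?c \<otimes>\<^bsub>G\<^esub> g \<otimes>\<^bsub>G\<^esub> inv\<^bsub>G\<^esub> ?c \<otimes>\<^bsub>G\<^esub> inv\<^bsub>G\<^esub> g) = ?N"
        by (rule N.rcos_const[OF is_group])
      then have e: "?h ?c \<otimes>\<^bsub>G Mod ?N\<^esub> ?h g \<otimes>\<^bsub>G Mod ?N\<^esub> inv\<^bsub>G Mod ?N\<^esub> ?h ?c \<otimes>\<^bsub>G Mod ?N\<^esub> inv\<^bsub>G Mod ?N\<^esub> ?h g = \<one>\<^bsub>G Mod ?N\<^esub>"
        using h.hom_mult h.hom_inv cG g(1) by (simp del: lower_central_series.simps add: FactGroup_def)
      have "?h ?c \<otimes>\<^bsub>G Mod ?N\<^esub> ?h g = ?h g \<otimes>\<^bsub>G Mod ?N\<^esub> ?h ?c"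
        by (rule Q.commute_if_commutator_eq_one[OF h.hom_closed[OF cG] h.hom_closed[OF g(1)] e])
      then show "(?h x \<otimes>\<^bsub>G Mod ?N\<^esub> ?h y \<otimes>\<^bsub>G Mod ?N\<^esub> inv\<^bsub>G Mod ?N\<^esub> ?h x \<otimes>\<^bsub>G Mod ?N\<^esub> inv\<^bsub>G Mod ?N\<^esub> ?h y) \<otimes>\<^bsub>G Mod ?N\<^esub> u
        = u \<otimes>\<^bsub>G Mod ?N\<^esub> (?h x \<otimes>\<^bsub>G Mod ?N\<^esub> ?h y \<otimes>\<^bsub>G Mod ?N\<^esub> inv\<^bsub>G Mod ?N\<^esub> ?h x \<otimes>\<^bsub>G Mod ?N\<^esub> inv\<^bsub>G Mod ?N\<^esub> ?h y)"
        unfolding hc[symmetric] g(2) .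
    qed (rule pow(3))
    then have "?h ?c = ?N" by (simp add: FactGroup_def del: lower_central_series.simps)
    then show ?case using rcos_self[OF cG N.subgroup_axioms] by (simp only:)
  qed
  then have "?c = \<one>\<^bsub>G\<^esub>" using nil unfolding nilpotent_group_def by blast
  then show ?thesis by (rule commute_if_commutator_eq_one[OF x y])
qed

section \<open>Left braces and their lambda maps\<close>

context left_brace
begin

abbreviation adj :: "'a monoid" where "adj \<equiv> adjoint_group A"

text \<open>The lambda map of brace theory, which turns circle products into sums:
  \<open>a \<circ> b = a + lam a b\<close>.\<close>
definition lam :: "'a \<Rightarrow> 'a \<Rightarrow> 'a" where
  "lam a b = a \<otimes> b \<oplus> b"

sublocale adj: group adj by (rule group_adjoint_group)

lemma carrier_adj [simp]: "carrier adj = carrier A"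
  and one_adj [simp]: "\<one>\<^bsub>adj\<^esub> = \<zero>"
  and order_adj [simp]: "order adj = order (add_monoid A)"
  by (simp_all add: adjoint_group_def order_def)

lemma adj_inv_closed: "a \<in> carrier A \<Longrightarrow> inv\<^bsub>adj\<^esub> a \<in> carrier A"
  using adj.inv_closed[of a] by simp

lemma lam_closed [simp]: "\<lbrakk>a \<in> carrier A; b \<in> carrier A\<rbrakk> \<Longrightarrow> lam a b \<in> carrier A"
  by (simp add: lam_def mult_closed)

lemma circle_eq: "\<lbrakk>a \<in> carrier A; b \<in> carrier A\<rbrakk> \<Longrightarrow> a \<otimes>\<^bsub>adj\<^esub> b = a \<oplus> lam a b"
  by (simp add: adjoint_group_def lam_def mult_closed a_ac)

lemma lam_add:
  "\<lbrakk>a \<in> carrier A; b \<in> carrier A; c \<in> carrier A\<rbrakk> \<Longrightarrow> lam a (b \<oplus> c) = lam a b \<oplus> lam a c"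
  by (simp add: lam_def left_distrib mult_closed a_ac)

text \<open>Associativity of \<open>\<circ>\<close>, after cancelling \<open>a + lam a b\<close>.\<close>
lemma lam_circle:
  assumes "a \<in> carrier A" "b \<in> carrier A" "c \<in> carrier A"
  shows "lam (a \<otimes>\<^bsub>adj\<^esub> b) c = lam a (lam b c)"
proof -
  have ab: "a \<otimes>\<^bsub>adj\<^esub> b \<in> carrier A" using adj.m_closed assms by simp
  have "(a \<oplus> lam a b) \<oplus> lam (a \<otimes>\<^bsub>adj\<^esub> b) c = (a \<otimes>\<^bsub>adj\<^esub> b) \<otimes>\<^bsub>adj\<^esub> c"
    using assms ab circle_eq by simp
  also have "\<dots> = a \<otimes>\<^bsub>adj\<^esub> (b \<otimes>\<^bsub>adj\<^esub> c)" using assms by (simp add: adj.m_assoc)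
  also have "\<dots> = (a \<oplus> lam a b) \<oplus> lam a (lam b c)"
    using assms by (simp add: circle_eq lam_add a_ac)
  finally show ?thesis using assms ab by simp
qed

lemma lam_zero: "c \<in> carrier A \<Longrightarrow> lam \<zero> c = c"
  using circle_eq[of \<zero> c] adj.l_one[of c] by simp

lemma lam_hom: "a \<in> carrier A \<Longrightarrow> lam a \<in> hom (add_monoid A) (add_monoid A)"
  by (simp add: hom_def lam_add)

sublocale lam: acts_by_automorphisms adj "add_monoid A" lam
  by unfold_locales (simp_all add: lam_hom lam_circle lam_zero)

lemma lam_minus_self:
  "\<lbrakk>a \<in> carrier A; b \<in> carrier A\<rbrakk> \<Longrightarrow> lam a b \<otimes>\<^bsub>add_monoid A\<^esub> inv\<^bsub>add_monoid A\<^esub> b = a \<otimes> b"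
  by (simp add: lam_def mult_closed a_inv_def[symmetric] a_assoc r_neg)

lemma mult_zero_iff: "\<lbrakk>a \<in> carrier A; b \<in> carrier A\<rbrakk> \<Longrightarrow> a \<otimes> b = \<zero> \<longleftrightarrow> lam a b = b"
  by (simp add: lam_def mult_closed)

lemma lam_pow:
  assumes "a \<in> carrier A" "b \<in> carrier A"
  shows "lam a (b [^]\<^bsub>add_monoid A\<^esub> (k::nat)) = lam a b [^]\<^bsub>add_monoid A\<^esub> k"
proof -
  interpret h: group_hom "add_monoid A" "add_monoid A" "lam a"
    using lam_hom[OF assms(1)] by unfold_locales
  show ?thesis using h.hom_nat_pow[of b k] assms(2) by simp
qed

text \<open>This is what makes the primary parts of the additive group Sylow subgroups of the adjoint
  group.\<close>
lemma invariant_subgroup_adjoint: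
  assumes L: "subgroup L (add_monoid A)" and inv: "\<And>a b. a \<in> carrier A \<Longrightarrow> b \<in> L \<Longrightarrow> lam a b \<in> L"
  shows "subgroup L adj"
proof (rule adj.subgroupI)
  have LA: "L \<subseteq> carrier A" using subgroup.subset[OF L] by simp
  show "L \<subseteq> carrier adj" using LA by simp
  show "L \<noteq> {}" using subgroup.one_closed[OF L] by auto
  show "a \<otimes>\<^bsub>adj\<^esub> b \<in> L" if "a \<in> L" "b \<in> L" for a b
    using subgroup.m_closed[OF L, of a "lam a b"] that subsetD[OF LA] inv[of a b] circle_eq[of a b] by simp
  show "inv\<^bsub>adj\<^esub> a \<in> L" if a: "a \<in> L" for a
  proof -
    have aA: "a \<in> carrier A" using a LA by auto
    have iA: "inv\<^bsub>adj\<^esub> a \<in> carrier A" using adj.inv_closed[of a] aA by simp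
    \<comment> \<open>The left inverse law reads \<open>inv a = - lam (inv a) a\<close>, with \<open>lam\<close> applied to an
      element of \<open>L\<close>.\<close>
    have "\<zero> = inv\<^bsub>adj\<^esub> a \<oplus> lam (inv\<^bsub>adj\<^esub> a) a"
      using adj.l_inv[of a] circle_eq[OF iA aA] aA by simp
    then have "inv\<^bsub>adj\<^esub> a = \<ominus> lam (inv\<^bsub>adj\<^esub> a) a"
      using aA iA by (metis lam_closed minus_equality)
    then show ?thesis
      using inv[OF iA a] subgroup.m_inv_closed[OF L] by (metis a_inv_def)
  qed
qed

section \<open>Primary parts of a brace\<close>

definition primary_part :: "nat \<Rightarrow> 'a set" where
  "primary_part p = primary_component (add_monoid A) p"

lemma primary_part_add_subgroup: "subgroup (primary_part p) (add_monoid A)"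
  unfolding primary_part_def by (rule add.primary_component_subgroup)

lemma primary_part_carrier: "x \<in> primary_part p \<Longrightarrow> x \<in> carrier A"
  using subgroup.mem_carrier[OF primary_part_add_subgroup] by simp

lemma lam_primary_part: "\<lbrakk>a \<in> carrier A; b \<in> primary_part p\<rbrakk> \<Longrightarrow> lam a b \<in> primary_part p"
  using group_hom.hom_one[of "add_monoid A" "add_monoid A" "lam a"] lam_hom[of a]
    lam_pow[of a b "p ^ multiplicity p (order (add_monoid A))"] a_group
  by (auto simp: primary_part_def primary_component_def group_hom_def group_hom_axioms_def)

lemma mult_primary_part: "\<lbrakk>a \<in> carrier A; b \<in> primary_part p\<rbrakk> \<Longrightarrow> a \<otimes> b \<in> primary_part p"
  using subgroup.m_closed[OF primary_part_add_subgroup lam_primary_part subgroup.m_inv_closed[OF primary_part_add_subgroup]]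
    lam_minus_self[of a b] primary_part_carrier by metis

lemma primary_part_adj_subgroup: "subgroup (primary_part p) adj"
  by (rule invariant_subgroup_adjoint[OF primary_part_add_subgroup lam_primary_part])

lemma coprime_primary_part_exponents:
  assumes "Factorial_Ring.prime p" "Factorial_Ring.prime q" "p \<noteq> q"
  shows "coprime (p ^ multiplicity p (order (add_monoid A))) (q ^ multiplicity q (order (add_monoid A)))"
  using assms by (simp add: primes_coprime)

lemma primary_part_add_pow: "x \<in> primary_part p \<Longrightarrow> x [^]\<^bsub>add_monoid A\<^esub> (p ^ multiplicity p (order (add_monoid A))) = \<zero>"
  by (simp add: primary_part_def primary_component_def)

lemma primary_part_disjoint:
  assumes "Factorial_Ring.prime p" "Factorial_Ring.prime q" "p \<noteq> q" "x \<in> primary_part p" "x \<in> primary_part q"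
  shows "x = \<zero>"
  using add.pow_coprime_eq_one[OF _ _ _ coprime_primary_part_exponents[OF assms(1-3)], of x]
    primary_part_add_pow assms primary_part_carrier by (simp add: add_pow_def)

text \<open>The link between all claims of the theorem: for finite \<open>A\<close> it is equivalent to nilpotency of
  the adjoint group and to the vanishing of some left power.\<close>
definition primary_parts_annihilate :: bool where
  "primary_parts_annihilate \<longleftrightarrow> (\<forall>p q a b. Factorial_Ring.prime p \<longrightarrow> Factorial_Ring.prime q \<longrightarrow> p \<noteq> q \<longrightarrow>
     a \<in> primary_part p \<longrightarrow> b \<in> primary_part q \<longrightarrow> a \<otimes> b = \<zero>)"

end

locale finite_left_brace = left_brace +
  assumes finite_carrier: "finite (carrier A)"
begin

lemma card_primary_part: "Factorial_Ring.prime p \<Longrightarrow> card (primary_part p) = p ^ multiplicity p (order (add_monoid A))"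
  unfolding primary_part_def by (rule add.card_primary_component) (simp_all add: finite_carrier)

lemma primary_part_adj_pow:
  "\<lbrakk>Factorial_Ring.prime p; x \<in> primary_part p\<rbrakk> \<Longrightarrow> x [^]\<^bsub>adj\<^esub> (p ^ multiplicity p (order (add_monoid A))) = \<zero>"
  using adj.subgroup_pow_card_eq_one[OF primary_part_adj_subgroup, of x p] card_primary_part by simp

text \<open>Elements of \<open>A\<^sub>p\<close> and \<open>A\<^sub>q\<close> commute in the nilpotent adjoint group, so \<open>a b = b a\<close>; the left
  side is in \<open>A\<^sub>q\<close>, the right side in \<open>A\<^sub>p\<close>.\<close>
lemma nilpotent_imp_primary_parts_annihilate:
  assumes nil: "nilpotent_group adj"
  shows primary_parts_annihilate
  unfolding primary_parts_annihilate_def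
proof (intro allI impI)
  fix p q a b assume pq: "Factorial_Ring.prime p" "Factorial_Ring.prime q" "p \<noteq> q"
    and a: "a \<in> primary_part p" and b: "b \<in> primary_part q"
  note A = primary_part_carrier[OF a] primary_part_carrier[OF b]
  have "a \<otimes>\<^bsub>adj\<^esub> b = b \<otimes>\<^bsub>adj\<^esub> a"
    using nilpotent_group_coprime_commute[OF nil, of a b, OF _ _ _ _ coprime_primary_part_exponents[OF pq]]
      primary_part_adj_pow pq a b A by simp
  then have "a \<otimes> b \<oplus> (a \<oplus> b) = b \<otimes> a \<oplus> (a \<oplus> b)"
    using A by (simp add: adjoint_group_def a_ac mult_closed)
  then have "a \<otimes> b = b \<otimes> a" using A by (simp add: mult_closed)
  then show "a \<otimes> b = \<zero>"
    using mult_primary_part[OF A(1) b] mult_primary_part[OF A(2) a] primary_part_disjoint[OF pq] by simp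
qed

end

section \<open>Left powers\<close>

context left_brace begin

abbreviation products :: "'a set \<Rightarrow> 'a set \<Rightarrow> 'a set" where
  "products C D \<equiv> (\<Union>c\<in>C. \<Union>d\<in>D. {c \<otimes> d})"

lemma brace_set_mult_subset:
  assumes K: "subgroup K (add_monoid A)" and CD: "products C D \<subseteq> K"
  shows "brace_set_mult A C D \<subseteq> K"
proof
  fix x assume "x \<in> brace_set_mult A C D"
  then obtain n :: nat and c d where x: "x = (\<Oplus>i\<in>{..<n}. c i \<otimes> d i)"
    and cd: "c \<in> {..<n} \<rightarrow> C" "d \<in> {..<n} \<rightarrow> D" by (auto simp: brace_set_mult_def)
  have KA: "K \<subseteq> carrier A" using subgroup.subset[OF K] by simp
  have mem: "c i \<otimes> d i \<in> K" if "i < n" for i using cd CD that by blast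
  have "m \<le> n \<Longrightarrow> (\<Oplus>i\<in>{..<m}. c i \<otimes> d i) \<in> K" for m
  proof (induction m)
    case 0 then show ?case using subgroup.one_closed[OF K] by simp
  next
    case (Suc m)
    have "(\<Oplus>i\<in>{..<Suc m}. c i \<otimes> d i) = c m \<otimes> d m \<oplus> (\<Oplus>i\<in>{..<m}. c i \<otimes> d i)"
      unfolding lessThan_Suc using Suc.prems mem KA by (subst finsum_insert) force+
    then show ?case using Suc mem[of m] subgroup.m_closed[OF K, of "c m \<otimes> d m"] by simp
  qed
  then show "x \<in> K" using x by simp
qed

lemma brace_set_mult_add_product:
  assumes C: "C \<subseteq> carrier A" and D: "D \<subseteq> carrier A"
    and x: "x \<in> brace_set_mult A C D" and u: "u \<in> C" and v: "v \<in> D"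
  shows "u \<otimes> v \<oplus> x \<in> brace_set_mult A C D"
proof -
  obtain n :: nat and c d where x: "x = (\<Oplus>i\<in>{..<n}. c i \<otimes> d i)"
    and cd: "c \<in> {..<n} \<rightarrow> C" "d \<in> {..<n} \<rightarrow> D" using x by (auto simp: brace_set_mult_def)
  have cdA: "c i \<otimes> d i \<in> carrier A" if "i < n" for i using cd C D that by (auto intro!: mult_closed)
  have uv: "u \<otimes> v \<in> carrier A" using u v C D by (auto intro!: mult_closed)
  let ?c = "c(n := u)" and ?d = "d(n := v)"
  have eq: "(\<Oplus>i\<in>{..<n}. ?c i \<otimes> ?d i) = (\<Oplus>i\<in>{..<n}. c i \<otimes> d i)"
    using cdA by (intro finsum_cong') auto
  have "(\<Oplus>i\<in>{..<Suc n}. ?c i \<otimes> ?d i) = u \<otimes> v \<oplus> x"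
    unfolding lessThan_Suc using cdA uv eq x by (subst finsum_insert) auto
  moreover have "?c \<in> {..<Suc n} \<rightarrow> C" "?d \<in> {..<Suc n} \<rightarrow> D" using cd u v by (auto simp: less_Suc_eq)
  ultimately show ?thesis unfolding brace_set_mult_def
    by (intro CollectI exI[of _ "Suc n"] exI[of _ ?c] exI[of _ ?d]) simp
qed

text \<open>Finite sums of products already contain their negatives, as \<open>- (c d) = c (- d)\<close> by left
  distributivity and \<open>D\<close> is closed under negation.\<close>
lemma brace_set_mult_eq_generate:
  assumes C: "C \<subseteq> carrier A" and D: "subgroup D (add_monoid A)"
  shows "brace_set_mult A C D = generate (add_monoid A) (products C D)"
proof
  have DA: "D \<subseteq> carrier A" using subgroup.subset[OF D] by simp
  have PA: "products C D \<subseteq> carrier A" using C DA by (auto intro!: mult_closed)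
  show "brace_set_mult A C D \<subseteq> generate (add_monoid A) (products C D)"
    by (rule brace_set_mult_subset[OF add.generate_is_subgroup])
      (use PA in \<open>auto intro: generate.incl\<close>)
  let ?M = "brace_set_mult A C D"
  have MA: "x \<in> carrier A" if "x \<in> ?M" for x
    using brace_set_mult_subset[OF add.subgroup_self, where C = C and D = D] PA that by auto
  have zero: "\<zero> \<in> ?M" unfolding brace_set_mult_def 
    by (intro CollectI exI[of _ "0::nat"]) auto
  have shift: "\<And>x. x \<in> ?M \<Longrightarrow> y \<oplus> x \<in> ?M" if "y \<in> generate (add_monoid A) (products C D)" for y
    using that
  proof (induction y rule: generate.induct)
    case one
    then show ?case using MA by simp
  next
    case (incl h)
    then show ?case using brace_set_mult_add_product[OF C DA] by auto
  next
    case (inv h)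
    then obtain c d where cd: "c \<in> C" "d \<in> D" "h = c \<otimes> d" by auto
    then have A: "c \<in> carrier A" "d \<in> carrier A" using C DA by auto
    have "c \<otimes> \<ominus> d \<oplus> c \<otimes> d = c \<otimes> \<zero>" using left_distrib[of c "\<ominus> d" d] A by (simp add: l_neg)
    moreover have "c \<otimes> \<zero> = \<zero>" using left_distrib[of c \<zero> \<zero>] A mult_closed[of c \<zero>] by simp
    ultimately have "inv\<^bsub>add_monoid A\<^esub> h = c \<otimes> \<ominus> d"
      using A cd(3) by (metis a_inv_closed a_inv_def minus_equality mult_closed)
    moreover have "\<ominus> d \<in> D" using subgroup.m_inv_closed[OF D cd(2)] by (simp add: a_inv_def)
    ultimately show ?case using brace_set_mult_add_product[OF C DA inv.prems cd(1)] by simp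
  next
    case (eng h1 h2)
    have "h1 \<in> carrier A" "h2 \<in> carrier A" "x \<in> carrier A"
      using eng.hyps eng.prems add.generate_in_carrier[OF PA] MA by auto
    then show ?case using eng.IH(1)[OF eng.IH(2)[OF eng.prems]] by (simp add: a_assoc)
  qed
  show "generate (add_monoid A) (products C D) \<subseteq> ?M"
  proof
    fix y assume y: "y \<in> generate (add_monoid A) (products C D)"
    then have "y \<in> carrier A" using add.generate_in_carrier[OF PA] by simp
    then show "y \<in> ?M" using shift[OF y zero] by simp
  qed
qed

lemma left_power_subgroup: "subgroup (left_power A (Suc n)) (add_monoid A)"
proof (induction n)
  case 0 show ?case using add.subgroup_self by simp
next
  case (Suc n)
  have "left_power A (Suc n) \<subseteq> carrier A" using subgroup.subset[OF Suc] by simp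
  then show ?case unfolding left_power.simps brace_set_mult_eq_generate[OF order_refl Suc]
    by (intro add.generate_is_subgroup) (auto intro!: mult_closed)
qed

lemma mult_left_power: 
  assumes "a \<in> carrier A" "b \<in> left_power A (Suc n)"
  shows "a \<otimes> b \<in> left_power A (Suc (Suc n))"
  unfolding left_power.simps brace_set_mult_eq_generate[OF order_refl left_power_subgroup]
  using assms by (auto intro!: generate.incl)

text \<open>Modulo the next left power, \<open>lam g\<close> fixes \<open>c = a b\<close> for every \<open>g\<close>, whereas \<open>lam a\<close> adds \<open>c\<close>
  to \<open>b\<close>. Hence each iteration of \<open>lam a\<close> adds one more \<open>c\<close>.\<close>
lemma lam_circle_pow_mod_left_power:
  assumes a: "a \<in> carrier A" and b: "b \<in> carrier A" and ab: "a \<otimes> b \<in> left_power A (Suc k)"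
  shows "lam (a [^]\<^bsub>adj\<^esub> (m::nat)) b \<ominus> (b \<oplus> (a \<otimes> b) [^]\<^bsub>add_monoid A\<^esub> m) \<in> left_power A (Suc (Suc k))"
proof (induction m)
  case 0
  show ?case using b lam_zero[OF b] subgroup.one_closed[OF left_power_subgroup[of "Suc k"]] 
    by (simp add: minus_eq r_neg)
next
  case (Suc m)
  let ?N = "left_power A (Suc (Suc k))"
  let ?g = "a [^]\<^bsub>adj\<^esub> m"
  let ?c = "a \<otimes> b"
  have g: "?g \<in> carrier A" using adj.nat_pow_closed[of a m] a by simp
  have c: "?c \<in> carrier A" using a b by (rule mult_closed)
  have cm: "?c [^]\<^bsub>add_monoid A\<^esub> m \<in> carrier A" using add.nat_pow_closed[OF c, of m] by (simp add: add_pow_def)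
  have "lam (a [^]\<^bsub>adj\<^esub> Suc m) b = lam ?g (b \<oplus> ?c)"
    using a b g by (simp add: lam_circle lam_def[of a b] a_comm mult_closed)
  also have "\<dots> = lam ?g b \<oplus> (?g \<otimes> ?c \<oplus> ?c)" using g b c by (simp add: lam_add lam_def[of _ ?c])
  finally have "lam (a [^]\<^bsub>adj\<^esub> Suc m) b \<ominus> (b \<oplus> ?c [^]\<^bsub>add_monoid A\<^esub> Suc m)
      = (lam ?g b \<ominus> (b \<oplus> ?c [^]\<^bsub>add_monoid A\<^esub> m)) \<oplus> ?g \<otimes> ?c"
    using g b c cm mult_closed[OF g c]
    by (simp add: minus_eq minus_add a_ac r_neg1 r_neg2 r_neg)
  then show ?case using Suc mult_left_power[OF g ab] subgroup.m_closed[OF left_power_subgroup[of "Suc k"]] 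
    by simp
qed

end

context finite_left_brace begin

text \<open>The product \<open>c = a b\<close> lies in every left power. For the induction step, iterate \<open>lam a\<close> as
  often as the \<open>p\<close>-part of the order says: \<open>b\<close> returns to itself, so this multiple of \<open>c\<close> lies in
  the next left power. As an element of \<open>A\<^sub>q\<close>, \<open>c\<close> is also annihilated by a power of \<open>q\<close>.\<close>
lemma left_nilpotent_imp_primary_parts_annihilate:
  assumes nil: "left_power A n = {\<zero>}" and n: "n \<ge> 1"
  shows primary_parts_annihilate
  unfolding primary_parts_annihilate_def
proof (intro allI impI)
  fix p q a b assume pq: "Factorial_Ring.prime p" "Factorial_Ring.prime q" "p \<noteq> q"
    and a: "a \<in> primary_part p" and b: "b \<in> primary_part q"
  note A = primary_part_carrier[OF a] primary_part_carrier[OF b]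
  let ?c = "a \<otimes> b"
  have c: "?c \<in> carrier A" using A by (rule mult_closed)
  let ?m = "p ^ multiplicity p (order (add_monoid A))" and ?n = "q ^ multiplicity q (order (add_monoid A))"
  have "?c \<in> left_power A (Suc k)" for k
  proof (induction k)
    case 0 show ?case using c by simp
  next
    case (Suc k)
    let ?N = "left_power A (Suc (Suc k))"
    have N: "subgroup ?N (add_monoid A)" by (rule left_power_subgroup)
    have cm: "?c [^]\<^bsub>add_monoid A\<^esub> ?m \<in> carrier A" using add.nat_pow_closed[OF c, of ?m] by (simp add: add_pow_def)
    have "b \<ominus> (b \<oplus> ?c [^]\<^bsub>add_monoid A\<^esub> ?m) \<in> ?N"
      using lam_circle_pow_mod_left_power[OF A Suc, of ?m] primary_part_adj_pow[OF pq(1) a] lam_zero[OF A(2)] by simp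
    then have "\<ominus> (?c [^]\<^bsub>add_monoid A\<^esub> ?m) \<in> ?N" using A cm by (simp add: minus_eq minus_add r_neg2)
    then have 1: "?c [^]\<^bsub>add_monoid A\<^esub> ?m \<in> ?N"
      using subgroup.m_inv_closed[OF N] cm by (metis a_inv_def minus_minus)
    have 2: "?c [^]\<^bsub>add_monoid A\<^esub> ?n \<in> ?N"
      using primary_part_add_pow[OF mult_primary_part[OF A(1) b]] subgroup.one_closed[OF N] by simp
    show ?case
      using group.coprime_powers_in_subgroup[OF a_group N _ 1 2 coprime_primary_part_exponents[OF pq]] c by simp
  qed
  then show "?c = \<zero>" using nil n by (metis Suc_pred' less_eq_Suc_le One_nat_def singletonD)
qed

section \<open>Nilpotency from annihilating primary parts\<close>

lemma lam_coprime_sylow_action: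
  assumes primary_parts_annihilate
  shows "coprime_sylow_action adj (add_monoid A) lam primary_part primary_part"
proof (intro coprime_sylow_action.intro coprime_sylow_action_axioms.intro)
  show "acts_by_automorphisms adj (add_monoid A) lam" by unfold_locales
  fix p q g h assume "Factorial_Ring.prime p" "Factorial_Ring.prime q" "p \<noteq> q" "g \<in> primary_part q" "h \<in> primary_part p"
  then show "lam g h = h"
    using assms mult_zero_iff[of g h] primary_part_carrier unfolding primary_parts_annihilate_def by metis
next
  fix K assume "acts_by_automorphisms.invariant_subgroup adj (add_monoid A) lam K"
  then show "K \<lhd> add_monoid A"
    by (simp add: lam.invariant_subgroup_def add.subgroup_imp_normal)
qed (use primary_part_adj_subgroup primary_part_add_subgroup card_primary_part lam_primary_part primary_part_carrier finite_carrier in auto)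

text \<open>Displacements under \<open>lam\<close> are products, so the left powers descend by displacements.\<close>
lemma primary_parts_annihilate_imp_left_nilpotent:
  assumes primary_parts_annihilate
  shows "\<exists>n\<ge>1. left_power A n = {\<zero>}"
proof -
  interpret L: coprime_sylow_action adj "add_monoid A" lam primary_part primary_part
    by (rule lam_coprime_sylow_action[OF assms])
  have "\<exists>n. left_power A (Suc n) \<subseteq> {\<one>\<^bsub>add_monoid A\<^esub>}"
  proof (rule L.descending_series_trivial)
    fix n K assume K: "subgroup K (add_monoid A)"
      and disp: "\<And>g h. \<lbrakk>g \<in> carrier adj; h \<in> left_power A (Suc n)\<rbrakk>
        \<Longrightarrow> lam g h \<otimes>\<^bsub>add_monoid A\<^esub> inv\<^bsub>add_monoid A\<^esub> h \<in> K"
    show "left_power A (Suc (Suc n)) \<subseteq> K"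
      unfolding left_power.simps
    proof (rule brace_set_mult_subset[OF K])
      show "products (carrier A) (left_power A (Suc n)) \<subseteq> K"
        using disp lam_minus_self subgroup.mem_carrier[OF left_power_subgroup] by fastforce
    qed
  qed simp
  then obtain n where "left_power A (Suc n) \<subseteq> {\<zero>}" by auto
  then have "left_power A (Suc n) = {\<zero>}"
    using subgroup.one_closed[OF left_power_subgroup[of n]] by auto
  then show ?thesis by (intro exI[of _ "Suc n"]) auto
qed

text \<open>If products across different primes vanish, elements of different primary parts commute in
  the adjoint group, so conjugation satisfies the same hypotheses as \<open>lam\<close> does.\<close>
lemma primary_parts_annihilate_imp_nilpotent:
  assumes ann: primary_parts_annihilate
  shows "nilpotent_group adj"
proof -
  let ?act = "\<lambda>g h. g \<otimes>\<^bsub>adj\<^esub> h \<otimes>\<^bsub>adj\<^esub> inv\<^bsub>adj\<^esub> g"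
  interpret C: acts_by_automorphisms adj adj ?act
  proof unfold_locales
    show "?act g \<in> hom adj adj" if "g \<in> carrier adj" for g
      by (rule homI) (use that in \<open>simp_all add: adj.m_assoc adj.inv_mult_cancel_left del: carrier_adj\<close>)
  qed (simp_all add: adj.m_assoc adj.inv_mult_group del: carrier_adj one_adj)
  interpret C: coprime_sylow_action adj adj ?act primary_part primary_part
  proof (intro coprime_sylow_action.intro coprime_sylow_action_axioms.intro)
    show "acts_by_automorphisms adj adj ?act" by unfold_locales
    fix p q g h assume pq: "Factorial_Ring.prime p" "Factorial_Ring.prime q" "p \<noteq> q"
      and gh: "g \<in> primary_part q" "h \<in> primary_part p"
    note A = primary_part_carrier[OF gh(1)] primary_part_carrier[OF gh(2)]
    have "g \<otimes> h = \<zero>" "h \<otimes> g = \<zero>" using ann pq gh unfolding primary_parts_annihilate_def by metis+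
    then have "g \<otimes>\<^bsub>adj\<^esub> h = h \<otimes>\<^bsub>adj\<^esub> g" using A by (simp add: adjoint_group_def a_comm)
    then show "?act g h = h" using A by (simp add: adj.m_assoc adj_inv_closed)
  next
    fix K assume "acts_by_automorphisms.invariant_subgroup adj adj ?act K"
    then show "K \<lhd> adj"
      unfolding C.invariant_subgroup_def by (intro adj.normal_invI) auto
  next
    fix p g h assume "Factorial_Ring.prime p" "g \<in> primary_part p" "h \<in> primary_part p"
    then show "?act g h \<in> primary_part p"
      by (simp add: primary_part_adj_subgroup subgroup.m_closed subgroup.m_inv_closed)
  qed (use primary_part_adj_subgroup card_primary_part finite_carrier in auto)
  have "\<exists>n. lower_central_series adj n \<subseteq> {\<one>\<^bsub>adj\<^esub>}"
  proof (rule C.descending_series_trivial)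
    fix n K assume K: "subgroup K adj"
      and disp: "\<And>g h. \<lbrakk>g \<in> carrier adj; h \<in> lower_central_series adj n\<rbrakk>
        \<Longrightarrow> ?act g h \<otimes>\<^bsub>adj\<^esub> inv\<^bsub>adj\<^esub> h \<in> K"
    have "h \<otimes>\<^bsub>adj\<^esub> g \<otimes>\<^bsub>adj\<^esub> inv\<^bsub>adj\<^esub> h \<otimes>\<^bsub>adj\<^esub> inv\<^bsub>adj\<^esub> g \<in> K"
      if h: "h \<in> lower_central_series adj n" and g: "g \<in> carrier adj" for g h
    proof -
      have hG: "h \<in> carrier adj"
        using h normal_imp_subgroup[OF adj.lower_central_series_normal] subgroup.mem_carrier by metis
      have "inv\<^bsub>adj\<^esub> (?act g h \<otimes>\<^bsub>adj\<^esub> inv\<^bsub>adj\<^esub> h) \<in> K"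
        using disp[OF g h] subgroup.m_inv_closed[OF K] by blast
      then show ?thesis using g hG by (simp add: adj.inv_mult_group adj.m_assoc del: carrier_adj)
    qed
    then show "lower_central_series adj (Suc n) \<subseteq> K"
      unfolding lower_central_series.simps by (intro adj.generate_subgroup_incl[OF _ K]) auto
  qed simp
  then obtain n where "lower_central_series adj n \<subseteq> {\<one>\<^bsub>adj\<^esub>}" by auto
  moreover have "\<one>\<^bsub>adj\<^esub> \<in> lower_central_series adj n"
    using normal_imp_subgroup[OF adj.lower_central_series_normal] by (rule subgroup.one_closed)
  ultimately have "lower_central_series adj n = {\<one>\<^bsub>adj\<^esub>}" by blast
  then show ?thesis using group_adjoint_group unfolding nilpotent_group_def by blast
qed

end

section \<open>Projections onto the primary parts\<close>

text \<open>Taking powers with such an exponent is the projection onto the \<open>p\<close>-component. The last clause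
  says that nothing of order divisible by \<open>p\<close> is lost, whence the projections are jointly
  injective.\<close>
definition is_projection_exponent :: "('a, 'b) monoid_scheme \<Rightarrow> nat \<Rightarrow> nat \<Rightarrow> bool" where
  "is_projection_exponent G p e \<longleftrightarrow>
     (\<forall>x\<in>carrier G. x [^]\<^bsub>G\<^esub> e \<in> primary_component G p) \<and>
     (\<forall>x\<in>primary_component G p. x [^]\<^bsub>G\<^esub> e = x) \<and>
     (\<forall>q x. Factorial_Ring.prime q \<longrightarrow> q \<noteq> p \<longrightarrow> x \<in> primary_component G q \<longrightarrow> x [^]\<^bsub>G\<^esub> e = \<one>\<^bsub>G\<^esub>) \<and>
     (\<forall>x\<in>carrier G. x [^]\<^bsub>G\<^esub> e = \<one>\<^bsub>G\<^esub> \<longrightarrow> \<not> p dvd group.ord G x)"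

lemma (in comm_group) projection_exponent_exists:
  assumes fin: "finite (carrier G)" and p: "Factorial_Ring.prime p"
  shows "\<exists>e. is_projection_exponent G p e"
proof -
  let ?a = "multiplicity p (order G)"
  have o0: "order G \<noteq> 0" using fin order_gt_0_iff_finite by simp
  obtain m where m: "order G = p ^ ?a * m" and pm: "\<not> p dvd m"
  proof (rule multiplicity_decompose'[OF o0])
    show "\<not> is_unit p" using prime_gt_1_nat[OF p] by simp
  qed blast
  from pm have cop: "coprime m (p ^ ?a)" using p by (simp add: prime_imp_coprime coprime_commute[of m])
  have m0: "m \<noteq> 0" using pm by (intro notI) simp
  \<comment> \<open>The exponent \<open>m u\<close> is 1 modulo the \<open>p\<close>-part of the order and 0 modulo its complement.\<close>
  obtain u v where uv: "m * u = p ^ ?a * v + 1" using bezout_nat[OF m0, of "p ^ ?a"] cop by auto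
  show ?thesis
    unfolding is_projection_exponent_def
  proof (intro exI[of _ "m * u"] conjI ballI allI impI)
    fix x assume x: "x \<in> carrier G"
    have "(x [^] (m * u)) [^] (p ^ ?a) = (x [^] (p ^ ?a * m)) [^] u"
      using x by (simp add: nat_pow_pow ac_simps)
    also have "x [^] (p ^ ?a * m) = \<one>" using pow_order_eq_1[OF x] by (subst m[symmetric])
    also have "\<one> [^] u = \<one>" by simp
    finally show "x [^] (m * u) \<in> primary_component G p" using x by (simp add: primary_component_def)
  next
    fix x assume x: "x \<in> primary_component G p"
    then have xG: "x \<in> carrier G" and 1: "x [^] (p ^ ?a) = \<one>" by (auto simp: primary_component_def)
    have "x [^] (m * u) = (x [^] (p ^ ?a)) [^] v \<otimes> x" unfolding uv using xG by (simp add: nat_pow_pow)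
    then show "x [^] (m * u) = x" using 1 xG by simp
  next
    fix q x assume q: "Factorial_Ring.prime q" "q \<noteq> p" and x: "x \<in> primary_component G q"
    let ?b = "multiplicity q (order G)"
    have xG: "x \<in> carrier G" and 1: "x [^] (q ^ ?b) = \<one>" using x by (auto simp: primary_component_def)
    have "q ^ ?b dvd p ^ ?a * m" using multiplicity_dvd[of q "order G"] by (subst m[symmetric])
    moreover have "coprime (q ^ ?b) (p ^ ?a)" using p q by (simp add: primes_coprime)
    ultimately have "q ^ ?b dvd m * u" by (simp add: coprime_dvd_mult_right_iff)
    then obtain w where "m * u = q ^ ?b * w" by (rule dvdE)
    then show "x [^] (m * u) = \<one>" using 1 xG by (simp flip: nat_pow_pow)
  next
    fix x assume x: "x \<in> carrier G" and 1: "x [^] (m * u) = \<one>"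
    show "\<not> p dvd ord x"
    proof
      assume p_ord: "p dvd ord x"
      then have "p dvd m * u" using 1 x pow_eq_id dvd_trans by blast
      moreover have "p dvd order G" using p_ord ord_dvd_group_order[OF x] dvd_trans by blast
      then have "p dvd p ^ ?a * m" by (subst (asm) m)
      then have "p dvd p ^ ?a" using pm prime_dvd_mult_iff[OF p] by blast
      ultimately have "p dvd 1" unfolding uv using dvd_add_right_iff[of p "p ^ ?a * v" 1] dvd_mult2 by blast
      then show False using p by (simp add: prime_nat_iff)
    qed
  qed
qed

context finite_left_brace begin

definition proj_exponent :: "nat \<Rightarrow> nat" where
  "proj_exponent p = (SOME e. is_projection_exponent (add_monoid A) p e)"

definition proj :: "nat \<Rightarrow> 'a \<Rightarrow> 'a" where
  "proj p x = x [^]\<^bsub>add_monoid A\<^esub> proj_exponent p"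

lemma proj_exponent_spec:
  assumes p: "Factorial_Ring.prime p"
  shows "(\<forall>x\<in>carrier A. proj p x \<in> primary_part p) \<and> (\<forall>x\<in>primary_part p. proj p x = x) \<and>
    (\<forall>q x. Factorial_Ring.prime q \<longrightarrow> q \<noteq> p \<longrightarrow> x \<in> primary_part q \<longrightarrow> proj p x = \<zero>) \<and>
    (\<forall>x\<in>carrier A. proj p x = \<zero> \<longrightarrow> \<not> p dvd group.ord (add_monoid A) x)"
proof -
  have "is_projection_exponent (add_monoid A) p (proj_exponent p)"
    unfolding proj_exponent_def
    by (rule someI_ex, rule comm_group.projection_exponent_exists[OF a_comm_group _ p])
      (simp add: finite_carrier)
  then show ?thesis
    by (simp only: is_projection_exponent_def proj_def primary_part_def monoid_record_simps)
qed

lemma proj_in_primary_part: "\<lbrakk>Factorial_Ring.prime p; x \<in> carrier A\<rbrakk> \<Longrightarrow> proj p x \<in> primary_part p"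
  by (drule proj_exponent_spec) (elim conjE, erule bspec)

lemma proj_id: "\<lbrakk>Factorial_Ring.prime p; x \<in> primary_part p\<rbrakk> \<Longrightarrow> proj p x = x"
  by (drule proj_exponent_spec) (elim conjE, erule bspec)

lemma proj_other:
  "\<lbrakk>Factorial_Ring.prime p; Factorial_Ring.prime q; q \<noteq> p; x \<in> primary_part q\<rbrakk> \<Longrightarrow> proj p x = \<zero>"
  using proj_exponent_spec[of p, THEN conjunct2, THEN conjunct2, THEN conjunct1] by fast

lemma proj_zero_ord:
  "\<lbrakk>Factorial_Ring.prime p; x \<in> carrier A; proj p x = \<zero>\<rbrakk> \<Longrightarrow> \<not> p dvd group.ord (add_monoid A) x"
  using proj_exponent_spec[of p, THEN conjunct2, THEN conjunct2, THEN conjunct2] by fast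

lemma proj_carrier: "\<lbrakk>Factorial_Ring.prime p; x \<in> carrier A\<rbrakk> \<Longrightarrow> proj p x \<in> carrier A"
  using proj_in_primary_part primary_part_carrier by blast

lemma proj_add: "\<lbrakk>x \<in> carrier A; y \<in> carrier A\<rbrakk> \<Longrightarrow> proj p (x \<oplus> y) = proj p x \<oplus> proj p y"
  using monoid.pow_mult_distrib[OF a_monoid, of x y "proj_exponent p"] by (simp add: proj_def a_comm)

lemma proj_lam: "\<lbrakk>a \<in> carrier A; x \<in> carrier A\<rbrakk> \<Longrightarrow> proj p (lam a x) = lam a (proj p x)"
  by (simp add: proj_def lam_pow)

text \<open>The elements \<open>x\<close> that act on \<open>A\<^sub>p\<close> as their \<open>p\<close>-component does form a subgroup of the adjoint
  group. It contains \<open>A\<^sub>p\<close> trivially, and the other \<open>A\<^sub>q\<close> because both \<open>x\<close> and its \<open>p\<close>-component 0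
  then act trivially.\<close>
lemma lam_proj:
  assumes ann: primary_parts_annihilate and p: "Factorial_Ring.prime p" and x: "x \<in> carrier A" and b: "b \<in> primary_part p"
  shows "lam (proj p x) b = lam x b"
proof -
  let ?K = "{x \<in> carrier A. \<forall>b\<in>primary_part p. lam (proj p x) b = lam x b}"
  have "?K = carrier adj"
  proof (rule adj.subgroup_containing_sylows_eq_carrier)
    show "subgroup ?K adj"
    proof (rule adj.subgroupI)
      have "proj p \<zero> = \<zero>" using proj_id[OF p] subgroup.one_closed[OF primary_part_add_subgroup] by simp
      then have "\<zero> \<in> ?K" by simp
      then show "?K \<noteq> {}" by blast
    next
      fix x y assume xy: "x \<in> ?K" "y \<in> ?K"
      then have A: "x \<in> carrier A" "y \<in> carrier A" "proj p x \<in> carrier A" "proj p y \<in> carrier A"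
        using proj_carrier[OF p] by simp_all
      have xyA: "x \<otimes>\<^bsub>adj\<^esub> y \<in> carrier A" using adj.m_closed A by simp
      have "proj p (x \<otimes>\<^bsub>adj\<^esub> y) = proj p x \<oplus> lam x (proj p y)"
        using A by (simp add: circle_eq proj_add proj_lam)
      also have "\<dots> = proj p x \<otimes>\<^bsub>adj\<^esub> proj p y"
        using xy A proj_in_primary_part[OF p] by (simp add: circle_eq)
      finally have "lam (proj p (x \<otimes>\<^bsub>adj\<^esub> y)) b = lam (x \<otimes>\<^bsub>adj\<^esub> y) b" if b: "b \<in> primary_part p" for b
        using xy A b primary_part_carrier[OF b] lam_primary_part[OF A(2) b] by (simp add: lam_circle)
      then show "x \<otimes>\<^bsub>adj\<^esub> y \<in> ?K" using xyA by simp
    next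
      fix x assume x: "x \<in> ?K"
      let ?i = "inv\<^bsub>adj\<^esub> x" and ?j = "inv\<^bsub>adj\<^esub> (proj p x)"
      have A: "x \<in> carrier A" "?i \<in> carrier A" "proj p x \<in> carrier A" "proj p ?i \<in> carrier A" "?j \<in> carrier A"
        using x proj_carrier[OF p] adj_inv_closed by simp_all
      have "proj p x \<otimes>\<^bsub>adj\<^esub> proj p ?i = proj p x \<oplus> lam x (proj p ?i)"
        using x A proj_in_primary_part[OF p] by (simp add: circle_eq)
      also have "\<dots> = proj p (x \<otimes>\<^bsub>adj\<^esub> ?i)" using A by (simp add: circle_eq proj_add proj_lam)
      also have "\<dots> = \<zero>"
        using adj.r_inv[of x] A proj_id[OF p] subgroup.one_closed[OF primary_part_add_subgroup] by simp
      finally have "proj p x \<otimes>\<^bsub>adj\<^esub> proj p ?i = \<one>\<^bsub>adj\<^esub>" by simp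
      then have "proj p ?i \<otimes>\<^bsub>adj\<^esub> proj p x = \<one>\<^bsub>adj\<^esub>" by (rule adj.inv_comm) (simp_all add: A)
      then have j: "proj p ?i = ?j" by (rule adj.inv_equality[symmetric]) (simp_all add: A)
      have "lam ?j b = lam ?i b" if b: "b \<in> primary_part p" for b
      proof -
        have ib: "lam ?i b \<in> primary_part p" using A b by (simp add: lam_primary_part)
        have "b = lam x (lam ?i b)" using lam.act_inv_act(2)[of x b] A primary_part_carrier[OF b] by simp
        also have "\<dots> = lam (proj p x) (lam ?i b)" using x ib by simp
        finally have "lam ?j b = lam ?j (lam (proj p x) (lam ?i b))" by simp
        then show ?thesis using lam.act_inv_act(1)[of "proj p x" "lam ?i b"] A primary_part_carrier[OF ib] by simp
      qed
      then show "?i \<in> ?K" using A j by simp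
    qed auto
    fix q :: nat assume q: "Factorial_Ring.prime q"
    show "primary_part q \<subseteq> ?K"
    proof
      fix x assume x: "x \<in> primary_part q"
      show "x \<in> ?K"
      proof (cases "q = p")
        case True
        then show ?thesis using primary_part_carrier[OF x] proj_id[OF p, of x] x by simp
      next
        case False
        have "lam x b = b" if "b \<in> primary_part p" for b
        proof -
          have "x \<otimes> b = \<zero>" using ann p q False x that unfolding primary_parts_annihilate_def by blast
          then show ?thesis using mult_zero_iff[OF primary_part_carrier[OF x] primary_part_carrier[OF that]] by simp
        qed
        then show ?thesis
          using proj_other[OF p q False x] primary_part_carrier[OF x] by (simp add: lam_zero primary_part_carrier)
      qed
    qed
  qed (use primary_part_adj_subgroup card_primary_part finite_carrier in auto)
  then have "x \<in> ?K" using x carrier_adj by blast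
  then show ?thesis using b by blast
qed

text \<open>The \<open>p\<close>-component of \<open>x y\<close> is \<open>x\<close> times the \<open>p\<close>-component of \<open>y\<close>, because \<open>lam x\<close> is additive.
  By \<open>lam_proj\<close>, the factor \<open>x\<close> may be replaced by its \<open>p\<close>-component.\<close>
lemma proj_mult:
  assumes ann: primary_parts_annihilate and p: "Factorial_Ring.prime p" and x: "x \<in> carrier A" and y: "y \<in> carrier A"
  shows "proj p (x \<otimes> y) = proj p x \<otimes> proj p y"
proof -
  have A: "proj p x \<in> carrier A" "proj p y \<in> carrier A" "x \<otimes> y \<in> carrier A"
    using proj_carrier[OF p] x y mult_closed by auto
  have "proj p (x \<otimes> y) \<oplus> proj p y = lam x (proj p y)"
    using proj_lam[OF x y, of p] proj_add[OF A(3) y, of p] by (simp add: lam_def)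
  also have "\<dots> = proj p x \<otimes> proj p y \<oplus> proj p y"
    using lam_proj[OF ann p x proj_in_primary_part[OF p y]] by (simp add: lam_def)
  finally show ?thesis using A proj_carrier[OF p A(3)] mult_closed[OF A(1,2)] by simp
qed

section \<open>Decomposition into braces of prime power order\<close>

definition primary_brace :: "nat \<Rightarrow> 'a ring" where
  "primary_brace p = \<lparr>carrier = primary_part p, monoid.mult = (\<otimes>), one = \<zero>, ring.zero = \<zero>, ring.add = (\<oplus>)\<rparr>"

lemma left_brace_primary_brace: "left_brace (primary_brace p)"
proof (intro left_brace.intro left_brace_axioms.intro)
  have sub: "primary_part p \<subseteq> carrier A" using primary_part_carrier by blast
  note cl = subgroup.m_closed[OF primary_part_add_subgroup, of _ p, simplified]
  show "abelian_group (primary_brace p)"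
  proof (rule abelian_groupI)
    show "\<exists>y\<in>carrier (primary_brace p). y \<oplus>\<^bsub>primary_brace p\<^esub> x = \<zero>\<^bsub>primary_brace p\<^esub>"
      if "x \<in> carrier (primary_brace p)" for x
      using subgroup.m_inv_closed[OF primary_part_add_subgroup, of x p] that primary_part_carrier[of x p]
      by (auto simp: primary_brace_def a_inv_def[symmetric] l_neg intro!: bexI[of _ "\<ominus> x"])
  qed (use sub cl subgroup.one_closed[OF primary_part_add_subgroup, of p] in
        \<open>auto simp: primary_brace_def a_ac subset_iff\<close>)
  show "group (adjoint_group (primary_brace p))"
    using adj.subgroup_imp_group[OF primary_part_adj_subgroup[of p]]
    by (simp add: adjoint_group_def primary_brace_def)
qed (use primary_part_carrier mult_primary_part in \<open>auto simp: primary_brace_def left_distrib\<close>)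

text \<open>The map is injective because an element in its kernel has order divisible by no prime, and
  bijective because both sides have the same number of elements.\<close>
lemma iso_direct_sum_of_primary_braces:
  assumes ann: primary_parts_annihilate
  defines "I \<equiv> prime_factors (order (add_monoid A))"
  shows "(\<lambda>x. \<lambda>p\<in>I. proj p x) \<in> brace_iso A (brace_direct_sum I primary_brace)"
proof -
  let ?f = "\<lambda>x. \<lambda>p\<in>I. proj p x"
  let ?D = "brace_direct_sum I primary_brace"
  have N0: "order (add_monoid A) > 0" using add.order_gt_0_iff_finite finite_carrier by simp
  have I: "Factorial_Ring.prime p" if "p \<in> I" for p using that by (auto simp: I_def)
  have finI: "finite I" by (simp add: I_def)
  have cD: "carrier ?D = (\<Pi>\<^sub>E p\<in>I. primary_part p)" by (simp add: brace_direct_sum_def primary_brace_def)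
  have into: "?f ` carrier A \<subseteq> carrier ?D" unfolding cD using I proj_in_primary_part by auto
  have hom_add: "?f (x \<oplus> y) = ?f x \<oplus>\<^bsub>?D\<^esub> ?f y" if "x \<in> carrier A" "y \<in> carrier A" for x y
    using that by (auto simp: brace_direct_sum_def primary_brace_def proj_add)
  have hom_mult: "?f (x \<otimes> y) = ?f x \<otimes>\<^bsub>?D\<^esub> ?f y" if "x \<in> carrier A" "y \<in> carrier A" for x y
    using that by (auto simp: brace_direct_sum_def primary_brace_def proj_mult[OF ann I])
  have ker: "x = \<zero>" if x: "x \<in> carrier A" and z: "\<And>p. p \<in> I \<Longrightarrow> proj p x = \<zero>" for x
  proof (rule ccontr)
    assume "x \<noteq> \<zero>"
    then have "group.ord (add_monoid A) x \<noteq> 1" using add.ord_eq_1[of x] x by simp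
    then obtain p where p: "Factorial_Ring.prime p" "p dvd group.ord (add_monoid A) x" 
      using prime_factor_nat by blast
    have "group.ord (add_monoid A) x dvd order (add_monoid A)" using add.ord_dvd_group_order[of x] x by simp
    then have "p \<in> I" using p N0 by (auto simp: I_def in_prime_factors_iff intro: dvd_trans)
    then show False using proj_zero_ord[OF p(1) x z] p(2) by simp
  qed
  have inj: "inj_on ?f (carrier A)"
  proof (rule inj_onI)
    fix x y assume xy: "x \<in> carrier A" "y \<in> carrier A" "?f x = ?f y"
    have "proj p (x \<ominus> y) = \<zero>" if "p \<in> I" for p
    proof -
      have "proj p x = proj p y" using fun_cong[OF xy(3), of p] that by simp
      moreover have "proj p (x \<ominus> y) \<oplus> proj p y = proj p x"
        using proj_add[of "x \<ominus> y" y p] xy by (simp add: minus_eq a_assoc l_neg)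
      moreover have "proj p (x \<ominus> y) \<in> carrier A" "proj p y \<in> carrier A" using proj_carrier[OF I[OF that]] xy by auto
      ultimately show ?thesis by simp
    qed
    then have "x \<ominus> y = \<zero>" using ker[of "x \<ominus> y"] xy by simp
    moreover have "(x \<ominus> y) \<oplus> y = x" using xy by (simp add: minus_eq a_assoc l_neg)
    ultimately show "x = y" using xy(2) by simp
  qed
  have "card (carrier ?D) = (\<Prod>p\<in>I. p ^ multiplicity p (order (add_monoid A)))"
    unfolding cD using card_PiE[OF finI, of primary_part] card_primary_part I by simp
  also have "\<dots> = order (add_monoid A)" 
    using prime_factorization_nat[OF N0] by (simp add: I_def)
  finally have cardD: "card (carrier ?D) = card (carrier A)" by (simp add: order_def)
  have "finite (carrier ?D)" using cardD N0 by (intro card_ge_0_finite) (simp add: order_def)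
  then have "?f ` carrier A = carrier ?D"
    using into by (rule card_subset_eq) (simp add: card_image[OF inj] cardD)
  then have bij: "bij_betw ?f (carrier A) (carrier ?D)" using inj by (simp add: bij_betw_def)
  have "?f \<in> iso (add_monoid A) (add_monoid ?D)" "?f \<in> iso A ?D"
    using bij into by (auto simp: iso_def hom_def hom_add hom_mult simp del: restrict_apply)
  then show ?thesis by (simp add: brace_iso_def)
qed

end

theorem theorem1:
  fixes A :: "('a, 'b) ring_scheme"
  assumes "left_brace A"
    and "finite (carrier A)"
  shows "(nilpotent_group (adjoint_group A) \<longleftrightarrow> (\<exists>n\<ge>1. left_power A n = {\<zero>\<^bsub>A\<^esub>})) \<and>
    (nilpotent_group (adjoint_group A) \<longrightarrow>
      (\<exists>(I :: nat set) (B :: nat \<Rightarrow> 'a ring) f.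
         finite I \<and>
         (\<forall>i\<in>I. left_brace (B i) \<and> primepow (card (carrier (B i)))) \<and>
         f \<in> brace_iso A (brace_direct_sum I B)))"
proof -
  interpret finite_left_brace A
    using assms by (simp add: finite_left_brace_def finite_left_brace_axioms_def)
  let ?I = "prime_factors (order (add_monoid A))"
  have "left_brace (primary_brace p) \<and> primepow (card (carrier (primary_brace p)))" if "p \<in> ?I" for p
  proof
    have p: "Factorial_Ring.prime p" using that by auto
    have "multiplicity p (order (add_monoid A)) > 0" using that by (simp add: prime_factors_multiplicity)
    then show "primepow (card (carrier (primary_brace p)))"
      using card_primary_part[OF p] p by (auto simp: primary_brace_def primepow_def)
  qed (rule left_brace_primary_brace)
  moreover have "nilpotent_group adj \<longleftrightarrow> primary_parts_annihilate"
    using nilpotent_imp_primary_parts_annihilate primary_parts_annihilate_imp_nilpotent by blast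
  moreover have "(\<exists>n\<ge>1. left_power A n = {\<zero>\<^bsub>A\<^esub>}) \<longleftrightarrow> primary_parts_annihilate"
    using left_nilpotent_imp_primary_parts_annihilate primary_parts_annihilate_imp_left_nilpotent by blast
  moreover have "finite ?I" by simp
  ultimately show ?thesis using iso_direct_sum_of_primary_braces by blast
qed

end
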